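(* Let $\mathfrak g$ be of type $D_4^{(3)}$ and $\lambda=\Lambda_0$, or of type $G_2^{(1)}$ and $\lambda\in\{\Lambda_0,\Lambda_2\}$. Let $\mathcal Y(\lambda)$ be the set of reduced Young walls built on the ground-state wall $Y_\lambda$. Then the maps $\mathrm{wt}:\mathcal Y(\lambda)\to P$, $\tilde E_i,\tilde F_i:\mathcal Y(\lambda)\to\mathcal Y(\lambda)\cup\{0\}$ and $\epsilon_i,\phi_i:\mathcal Y(\lambda)\to\mathbb Z$ ($i\in\{0,1,2\}$) define an affine crystal structure on the set $\mathcal Y(\lambda)$.
   Context: **Cartan data.** $I=\{0,1,2\}$; simple coroots $h_i$, simple roots $\alpha_i$, fundamental weights $\Lambda_i$, affine weight lattice $P$, $\langle h_i,\alpha_j\rangle=a_{ij}$. The Cartan matrix $(a_{ij})$ has rows $(2,-1,0),(-1,2,-3),(0,-1,2)$ for $D_4^{(3)}$ and $(2,-1,0),(-1,2,-1),(0,-3,2)$ for $G_2^{(1)}$. The canonical central element is $c=h_0+2h_1+3h_2$, resp. $c=h_0+2h_1+h_2$. The level-1 ($\lambda(c)=1$) dominant integral weights are $\Lambda_0$ for $D_4^{(3)}$, and $\Lambda_0,\Lambda_2$ for $G_2^{(1)}$. **Crystals.** An affine crystal is a set $B$ with maps $\mathrm{wt}:B\to P$, $\tilde e_i,\tilde f_i:B\to B\cup\{0\}$, $\varepsilon_i,\varphi_i:B\to\mathbb Z\cup\{-\infty\}$ satisfying: $\varphi_i(b)=\varepsilon_i(b)+\langle h_i,\mathrm{wt}(b)\rangle$;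 if $\tilde e_ib\in B$ then $\mathrm{wt}(\tilde e_ib)=\mathrm{wt}(b)+\alpha_i$, $\varepsilon_i(\tilde e_ib)=\varepsilon_i(b)-1$, $\varphi_i(\tilde e_ib)=\varphi_i(b)+1$; if $\tilde f_ib\in B$ then $\mathrm{wt}(\tilde f_ib)=\mathrm{wt}(b)-\alpha_i$, $\varepsilon_i(\tilde f_ib)=\varepsilon_i(b)+1$, $\varphi_i(\tilde f_ib)=\varphi_i(b)-1$; for $b,b'\in B$, $\tilde f_ib=b'$ iff $b=\tilde e_ib'$; and $\tilde e_ib=\tilde f_ib=0$ if $\varphi_i(b)=-\infty$. In the claim, $\tilde E_i,\tilde F_i,\epsilon_i,\phi_i$ play the roles of $\tilde e_i,\tilde f_i,\varepsilon_i,\varphi_i$. **Blocks (column pattern).** A column is built from colored blocks stacked in rows indexed by $\mathbb Z$ (the pictures of the paper encoded by labels; a label determines a position in the column). Type $D_4^{(3)}$: for each $n\in\mathbb Z$, row $2n$ contains a $0$-block $Z_n$ and a $2$-block $W_n$; row $2n+1$ contains two $1$-blocks $P_n$ (the one lying over $Z_n$) and $Q_n$ (the other one). Type $G_2^{(1)}$: for each $n\in\mathbb Z$, row $2n$ contains a $0$-block $Z_n$ and two $2$-blocks $A_n,B_n$ (with $B_n$ resting partly on $A_n$); row $2n+1$ contains two $1$-blocks $X_n,Y_n$ ($Y_n$ lying over $Z_n$) and a $2$-block $V_n$ lying on top of $Y_n$. Let $J_n$ be the set of all blocks in rows $\le 2n-1$. **Young columns.** These are exactly the following sets of blocks ($n\in\mathbb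 Z$ arbitrary). Type $D_4^{(3)}$: class $c_1$: $J_n\cup\{Z_n,W_n,Q_n,Z_{n+1}\}$; $c_2$: $J_n\cup\{Z_n\}$; $c_3$: $J_n\cup\{Z_n,W_n\}$; $c_0$: $J_n\cup\{Z_n,W_n,P_n\}$; $c_{\bar3}$: $J_n$; $c_{\bar2}$: $J_n\cup\{W_n\}$; $c_{\bar1}$: $J_n\cup\{W_n,Q_n\}$; $c_\phi$: $J_n\cup\{W_n,Q_n,Z_{n+1}\}$. Type $G_2^{(1)}$: $c'_1$: $J_n\cup\{Z_n,A_n,B_n,X_n,Z_{n+1}\}$; $c'_2$: $J_n\cup\{Z_n,A_n,B_n,X_n,Y_n,Z_{n+1}\}$; $c'_3$: $J_n\cup\{Z_n\}$; $c'_4$: $J_n\cup\{Z_n,A_n\}$; $c'_5$: $J_n\cup\{Z_n,A_n,Y_n\}$; $c'_6$: $J_n\cup\{Z_n,A_n,B_n\}$; $c'_7$: $J_n\cup\{Z_n,A_n,B_n,Y_n\}$; $c'_{\bar7}$: $J_n\cup\{Z_n,A_n,Y_n,V_n\}$; $c'_{\bar6}$: $J_n\cup\{Z_n,A_n,B_n,Y_n,X_n\}$; $c'_{\bar5}$: $J_n\cup\{Z_n,A_n,B_n,Y_n,V_n\}$; $c'_{\bar4}$: $J_n$; $c'_{\bar3}$: $J_n\cup\{A_n\}$; $c'_{\bar2}$: $J_n\cup\{A_n,B_n\}$; $c'_{\bar1}$: $J_n\cup\{A_n,B_n,X_n\}$; $c'_0$: $J_n\cup\{A_n,B_n,X_n,Z_{n+1}\}$.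 Two Young columns are equivalent iff they have the same class name (differ by a shift of $n$; geometrically, up to vertical position and $180^\circ$ horizontal rotation). $C_1$ (resp. $C'_1$) is the set of the 8 (resp. 15) classes. **Signatures of columns.** $\mathrm{sign}_i(y)=(-,\dots,-,+,\dots,+)$ with $r$ minus signs and $a$ plus signs, written $(r,a)$; pairs not listed are $(0,0)$. $D_4^{(3)}$, classes by subscript. $\mathrm{sign}_0$: $1:(2,0)$; $2,3:(1,0)$; $\bar3,\bar2:(0,1)$; $\bar1:(0,2)$; $\phi:(1,1)$. $\mathrm{sign}_1$: $1:(0,1)$; $2:(1,0)$; $3:(0,2)$; $0:(1,1)$; $\bar3:(2,0)$; $\bar2:(0,1)$; $\bar1:(1,0)$. $\mathrm{sign}_2$: $2:(0,1)$; $3:(1,0)$; $\bar3:(0,1)$; $\bar2:(1,0)$. $G_2^{(1)}$. $\mathrm{sign}_0$: $1:(2,0)$; $2,3,4,6:(1,0)$; $\bar6,\bar4,\bar3,\bar2:(0,1)$; $\bar1:(0,2)$; $0:(1,1)$. $\mathrm{sign}_1$: $1:(0,1)$; $2:(1,0)$; $4:(0,1)$; $5:(1,0)$; $6:(0,2)$; $7:(1,1)$; $\bar6:(2,0)$; $\bar5:(0,1)$; $\bar4:(1,0)$; $\bar2:(0,1)$; $\bar1:(1,0)$. $\mathrm{sign}_2$: $2:(0,3)$; $3:(1,2)$; $4:(2,1)$; $6:(3,0)$; $5:(0,2)$; $\bar7:(1,1)$; $\bar5:(2,0)$; $\bar6:(0,3)$; $\bar4:(1,2)$; $\bar3:(2,1)$;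 $\bar2:(3,0)$. "Adding (removing) an $i$-block" to (from) a Young column means passing to the unique Young column obtained by adding (removing) a single $i$-block; by convention, in type $G_2^{(1)}$ no $2$-block may be added to or removed from a column of class $c'_7$, and no $2$-block may be added or removed so as to reach a column of class $c'_7$. **Energy function.** For classes $x,y$, $H(x\otimes y)\in\{0,1,2\}$ is as follows. $D_4^{(3)}$: put $A_0=\{c_0,c_1,c_2,c_3\}$, $\bar A_0=\{c_0,c_{\bar1},c_{\bar2},c_{\bar3}\}$, $A_1=C_1\setminus\{c_\phi\}$, $A_2=\{c_2,c_3,c_0,c_{\bar3},c_{\bar2}\}$, $A_3=\{c_3,c_0,c_{\bar3}\}$; $\mathbf A=\{(c_\phi,c_\phi),(c_2,c_{\bar2})\}\cup A_0\times\{c_{\bar1}\}\cup\{c_1\}\times\bar A_0$; $\mathbf B=\bigcup_{i=1}^3(A_i\times\{c_i\}\cup\{c_{\bar i}\}\times A_i)$. Then $H=0$ on $\mathbf A$, $2$ on $\mathbf B$, $1$ otherwise. $G_2^{(1)}$: put $D_0=\{c'_1,c'_2,c'_3,c'_4,c'_5,c'_{\bar7}\}$, $\bar D_0=\{c'_{\bar1},c'_{\bar2},c'_{\bar3},c'_{\bar4},c'_{\bar5},c'_{\bar7}\}$, $D'_0=\{c'_5,c'_7,c'_{\bar6}\}$, $\bar D'_0=\{c'_6,c'_7,c'_{\bar5}\}$, $D_1=\bar D_1=C'_1\setminus\{c'_0\}$, $D_2=\bar D_2=C'_1\setminus\{c'_0,c'_1,c'_{\bar1}\}$, $D_3=\{c'_{\bar5},c'_6,c'_7,c'_{\bar6},c'_{\bar4},c'_{\bar3}\}$,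 $\bar D_3=\{c'_{\bar6},c'_5,c'_7,c'_6,c'_4,c'_3\}$, $D_4=D_3\setminus\{c'_{\bar3}\}$, $\bar D_4=\bar D_3\setminus\{c'_3\}$, $D_5=\{c'_{\bar6}\}$, $\bar D_5=\{c'_6\}$, $D_6=\bar D_6=\{c'_6,c'_7,c'_{\bar6}\}$; $\mathbf X=\{(c'_0,c'_0)\}\cup D_0\times\bar D_0\cup\{c'_1\}\times D'_0\cup\bar D'_0\times\{c'_{\bar1}\}$; $\mathbf Y=\bigcup_{i=1}^6(D_i\times\{c'_i\}\cup\{c'_{\bar i}\}\times\bar D_i)$. Then $H=0$ on $\mathbf X$, $2$ on $\mathbf Y$, $1$ otherwise. **Young walls.** The ground-state wall $Y_\lambda$ is the sequence $(\dots,g,g,g)$ with every column equal to the ground-state column $g$: for $D_4^{(3)}$, $\lambda=\Lambda_0$: $g=J_0\cup\{W_0,Q_0,Z_1\}$ (class $c_\phi$); for $G_2^{(1)}$, $\lambda=\Lambda_0$: $g=J_0\cup\{A_0,B_0,X_0,Z_1\}$ (class $c'_0$); for $G_2^{(1)}$, $\lambda=\Lambda_2$: $g=J_1\cup\{Z_1,A_1,Y_1,V_1\}$ (class $c'_{\bar7}$). A Young wall built on $Y_\lambda$ is a sequence $Y=(\dots,y_2,y_1,y_0)$ of Young columns such that $g\subseteq y_k$ for all $k\geq0$, $y_k=g$ for $k\gg0$ (finitely many blocks are added), and $y_{k+1}\subseteq y_k$ for all $k$ (each block of the left column has a block in the same position in the right column). $|y_k|_0$ is the number of $0$-blocks of $y_k\setminus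 g$. $Y$ is reduced if $H(y_{k+1}\otimes y_k)+|y_{k+1}|_0-|y_k|_0=0$ for all $k\ge0$, where $H$ is evaluated on the classes of the columns. $\mathcal Y(\lambda)$ is the set of reduced Young walls built on $Y_\lambda$. **Operators on walls.** The $i$-signature of $Y$ is obtained from the sequence of signs $(\dots,\mathrm{sign}_i(y_1),\mathrm{sign}_i(y_0))$ by cancelling every $(+,-)$ pair ($+$ to the left of $-$), leaving a finite sequence of $-$'s followed by $+$'s. $\tilde E_iY$ is obtained by removing an $i$-block from the column corresponding to the right-most $-$ of the $i$-signature ($\tilde E_iY=0$ if there is no $-$). $\tilde F_iY$ is obtained by adding an $i$-block to the column corresponding to the left-most $+$ ($\tilde F_iY=0$ if there is no $+$). Further, $\mathrm{wt}(Y)=\lambda-\sum_{i}k_i\alpha_i$, where $k_i$ is the number of $i$-blocks added to $Y_\lambda$ to obtain $Y$; $\epsilon_i(Y)$ and $\phi_i(Y)$ are the numbers of $-$'s and $+$'s in the $i$-signature of $Y$. *)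

theory Defs
  imports "HOL-Analysis.Finite_Cartesian_Product"
begin

section \<open>Cartan data\<close>

datatype cartan_type = D43 | G21

datatype index = I0 | I1 | I2

instance index :: finite
proof
  have "(UNIV :: index set) \<subseteq> {I0, I1, I2}"
    using index.exhaust by blast
  then show "finite (UNIV :: index set)"
    by (rule finite_subset) simp
qed

fun cartan :: "cartan_type \<Rightarrow> index \<Rightarrow> index \<Rightarrow> int" where
  "cartan D43 I0 I0 = 2"  | "cartan D43 I0 I1 = -1" | "cartan D43 I0 I2 = 0"
| "cartan D43 I1 I0 = -1" | "cartan D43 I1 I1 = 2"  | "cartan D43 I1 I2 = -3"
| "cartan D43 I2 I0 = 0"  | "cartan D43 I2 I1 = -1" | "cartan D43 I2 I2 = 2"
| "cartan G21 I0 I0 = 2"  | "cartan G21 I0 I1 = -1" | "cartan G21 I0 I2 = 0"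
| "cartan G21 I1 I0 = -1" | "cartan G21 I1 I1 = 2"  | "cartan G21 I1 I2 = -1"
| "cartan G21 I2 I0 = 0"  | "cartan G21 I2 I1 = -3" | "cartan G21 I2 I2 = 2"

text \<open>
  The affine weight lattice \<open>P\<close> is the free abelian group on the fundamental weights
  and the null root \<open>\<delta>\<close>; \<open>weight\<close> records the coordinates in that basis. The coroots
  satisfy \<open>\<langle>h\<^sub>i, \<Lambda>\<^sub>j\<rangle> = \<delta>\<^sub>i\<^sub>j\<close> and \<open>\<langle>h\<^sub>i, \<delta>\<rangle> = 0\<close>.
\<close>

datatype wbasis = Lam index | Del

instance wbasis :: finite
proof
  have "(UNIV :: wbasis set) \<subseteq> range Lam \<union> {Del}"
    using wbasis.exhaust by blast
  then show "finite (UNIV :: wbasis set)"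
    by (rule finite_subset) simp
qed

type_synonym weight = "int ^ wbasis"

definition fund_weight :: "index \<Rightarrow> weight" where
  "fund_weight i = axis (Lam i) 1"

definition null_root :: weight where
  "null_root = axis Del 1"

definition coroot_pairing :: "index \<Rightarrow> weight \<Rightarrow> int" where
  "coroot_pairing i \<mu> = \<mu> $ Lam i"

text \<open>
  \<open>\<alpha>\<^sub>j = \<Sum>\<^sub>i a\<^sub>i\<^sub>j \<Lambda>\<^sub>i\<close>, plus \<open>\<delta>\<close> for \<open>j = 0\<close>. In both types the label of the
  vertex 0 is 1 and \<open>\<delta>\<close> becomes the null root: \<open>\<delta> = \<alpha>\<^sub>0 + 2\<alpha>\<^sub>1 + \<alpha>\<^sub>2\<close> for \<open>D43\<close> and
  \<open>\<delta> = \<alpha>\<^sub>0 + 2\<alpha>\<^sub>1 + 3\<alpha>\<^sub>2\<close> for \<open>G21\<close>.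
\<close>

definition simple_root :: "cartan_type \<Rightarrow> index \<Rightarrow> weight" where
  "simple_root T j =
     (\<Sum>i\<in>UNIV. cartan T i j *s fund_weight i) + (if j = I0 then null_root else 0)"

section \<open>Affine crystals\<close>

text \<open>\<open>zminf\<close> is the set of integers with a bottom element \<open>-\<infinity>\<close> adjoined.\<close>

datatype zminf = Zfin int | Zminf

fun zadd :: "zminf \<Rightarrow> int \<Rightarrow> zminf" where
  "zadd (Zfin m) n = Zfin (m + n)"
| "zadd Zminf n = Zminf"

text \<open>The element \<open>0\<close> outside the crystal is rendered as \<open>None\<close>.\<close>

definition affine_crystal ::
  "cartan_type \<Rightarrow> 'b set \<Rightarrow> ('b \<Rightarrow> weight) \<Rightarrow>
   (index \<Rightarrow> 'b \<Rightarrow> 'b option) \<Rightarrow> (index \<Rightarrow> 'b \<Rightarrow> 'b option) \<Rightarrow>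
   (index \<Rightarrow> 'b \<Rightarrow> zminf) \<Rightarrow> (index \<Rightarrow> 'b \<Rightarrow> zminf) \<Rightarrow> bool" where
  "affine_crystal T B wt e f \<epsilon> \<phi> \<longleftrightarrow> (\<forall>i.
     (\<forall>b\<in>B. \<forall>b'. e i b = Some b' \<longrightarrow> b' \<in> B) \<and>
     (\<forall>b\<in>B. \<forall>b'. f i b = Some b' \<longrightarrow> b' \<in> B) \<and>
     (\<forall>b\<in>B. \<phi> i b = zadd (\<epsilon> i b) (coroot_pairing i (wt b))) \<and>
     (\<forall>b\<in>B. \<forall>b'\<in>B. e i b = Some b' \<longrightarrow>
        wt b' = wt b + simple_root T i \<and>
        \<epsilon> i b' = zadd (\<epsilon> i b) (-1) \<and> \<phi> i b' = zadd (\<phi> i b) 1) \<and>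
     (\<forall>b\<in>B. \<forall>b'\<in>B. f i b = Some b' \<longrightarrow>
        wt b' = wt b - simple_root T i \<and>
        \<epsilon> i b' = zadd (\<epsilon> i b) 1 \<and> \<phi> i b' = zadd (\<phi> i b) (-1)) \<and>
     (\<forall>b\<in>B. \<forall>b'\<in>B. f i b = Some b' \<longleftrightarrow> e i b' = Some b) \<and>
     (\<forall>b\<in>B. \<phi> i b = Zminf \<longrightarrow> e i b = None \<and> f i b = None))"

section \<open>Blocks and Young columns\<close>

text \<open>
  The pair \<open>(l, n)\<close> is the block of kind \<open>l\<close> with index \<open>n\<close>; for instance
  \<open>(bZ, n)\<close> is \<open>Z\<^sub>n\<close>. The kinds \<open>bZ\<close>, \<open>bW\<close>, \<open>bP\<close>, \<open>bQ\<close> occur in type \<open>D43\<close> and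
  \<open>bZ\<close>, \<open>bA\<close>, \<open>bB\<close>, \<open>bX\<close>, \<open>bY\<close>, \<open>bV\<close> in type \<open>G21\<close>.
\<close>

datatype blabel = bZ | bW | bP | bQ | bA | bB | bX | bY | bV

type_synonym block = "blabel \<times> int"

fun labels :: "cartan_type \<Rightarrow> blabel set" where
  "labels D43 = {bZ, bW, bP, bQ}"
| "labels G21 = {bZ, bA, bB, bX, bY, bV}"

fun block_row :: "block \<Rightarrow> int" where
  "block_row (l, n) = (if l \<in> {bZ, bW, bA, bB} then 2 * n else 2 * n + 1)"

fun block_colour :: "block \<Rightarrow> index" where
  "block_colour (l, n) =
     (if l = bZ then I0 else if l \<in> {bP, bQ, bX, bY} then I1 else I2)"

definition lower_blocks :: "cartan_type \<Rightarrow> int \<Rightarrow> block set" where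
  "lower_blocks T n = {b. fst b \<in> labels T \<and> block_row b \<le> 2 * n - 1}"

text \<open>
  Class names, shared by the two types: \<open>Km\<close>, \<open>Kbm\<close>, \<open>Kphi\<close> carry the subscripts
  \<open>m\<close>, \<open>m\<close> with a bar, and \<open>\<phi>\<close>.
\<close>

datatype cls = K0 | K1 | K2 | K3 | K4 | K5 | K6 | K7
  | Kb1 | Kb2 | Kb3 | Kb4 | Kb5 | Kb6 | Kb7 | Kphi

fun classes :: "cartan_type \<Rightarrow> cls set" where
  "classes D43 = {K1, K2, K3, K0, Kb3, Kb2, Kb1, Kphi}"
| "classes G21 = {K1, K2, K3, K4, K5, K6, K7, Kb7, Kb6, Kb5, Kb4, Kb3, Kb2, Kb1, K0}"

text \<open>The blocks that a column of given class contains besides \<open>J\<^sub>n\<close>.\<close>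

fun top_D43 :: "cls \<Rightarrow> int \<Rightarrow> block set" where
  "top_D43 K1 n = {(bZ, n), (bW, n), (bQ, n), (bZ, n + 1)}"
| "top_D43 K2 n = {(bZ, n)}"
| "top_D43 K3 n = {(bZ, n), (bW, n)}"
| "top_D43 K0 n = {(bZ, n), (bW, n), (bP, n)}"
| "top_D43 Kb3 n = {}"
| "top_D43 Kb2 n = {(bW, n)}"
| "top_D43 Kb1 n = {(bW, n), (bQ, n)}"
| "top_D43 Kphi n = {(bW, n), (bQ, n), (bZ, n + 1)}"
| "top_D43 _ n = {}"

fun top_G21 :: "cls \<Rightarrow> int \<Rightarrow> block set" where
  "top_G21 K1 n = {(bZ, n), (bA, n), (bB, n), (bX, n), (bZ, n + 1)}"
| "top_G21 K2 n = {(bZ, n), (bA, n), (bB, n), (bX, n), (bY, n), (bZ, n + 1)}"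
| "top_G21 K3 n = {(bZ, n)}"
| "top_G21 K4 n = {(bZ, n), (bA, n)}"
| "top_G21 K5 n = {(bZ, n), (bA, n), (bY, n)}"
| "top_G21 K6 n = {(bZ, n), (bA, n), (bB, n)}"
| "top_G21 K7 n = {(bZ, n), (bA, n), (bB, n), (bY, n)}"
| "top_G21 Kb7 n = {(bZ, n), (bA, n), (bY, n), (bV, n)}"
| "top_G21 Kb6 n = {(bZ, n), (bA, n), (bB, n), (bY, n), (bX, n)}"
| "top_G21 Kb5 n = {(bZ, n), (bA, n), (bB, n), (bY, n), (bV, n)}"
| "top_G21 Kb4 n = {}"
| "top_G21 Kb3 n = {(bA, n)}"
| "top_G21 Kb2 n = {(bA, n), (bB, n)}"
| "top_G21 Kb1 n = {(bA, n), (bB, n), (bX, n)}"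
| "top_G21 K0 n = {(bA, n), (bB, n), (bX, n), (bZ, n + 1)}"
| "top_G21 _ n = {}"

fun column_of :: "cartan_type \<Rightarrow> cls \<Rightarrow> int \<Rightarrow> block set" where
  "column_of D43 c n = lower_blocks D43 n \<union> top_D43 c n"
| "column_of G21 c n = lower_blocks G21 n \<union> top_G21 c n"

definition young_columns :: "cartan_type \<Rightarrow> block set set" where
  "young_columns T = {column_of T c n | c n. c \<in> classes T}"

definition class_of :: "cartan_type \<Rightarrow> block set \<Rightarrow> cls" where
  "class_of T y = (THE c. c \<in> classes T \<and> (\<exists>n. y = column_of T c n))"

section \<open>Signatures of columns\<close>

text \<open>The pair \<open>(r, a)\<close> stands for \<open>r\<close> minus signs followed by \<open>a\<close> plus signs.\<close>

fun sign_D43 :: "index \<Rightarrow> cls \<Rightarrow> nat \<times> nat" where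
  "sign_D43 I0 K1 = (2, 0)"
| "sign_D43 I0 K2 = (1, 0)"
| "sign_D43 I0 K3 = (1, 0)"
| "sign_D43 I0 Kb3 = (0, 1)"
| "sign_D43 I0 Kb2 = (0, 1)"
| "sign_D43 I0 Kb1 = (0, 2)"
| "sign_D43 I0 Kphi = (1, 1)"
| "sign_D43 I1 K1 = (0, 1)"
| "sign_D43 I1 K2 = (1, 0)"
| "sign_D43 I1 K3 = (0, 2)"
| "sign_D43 I1 K0 = (1, 1)"
| "sign_D43 I1 Kb3 = (2, 0)"
| "sign_D43 I1 Kb2 = (0, 1)"
| "sign_D43 I1 Kb1 = (1, 0)"
| "sign_D43 I2 K2 = (0, 1)"
| "sign_D43 I2 K3 = (1, 0)"
| "sign_D43 I2 Kb3 = (0, 1)"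
| "sign_D43 I2 Kb2 = (1, 0)"
| "sign_D43 _ _ = (0, 0)"

fun sign_G21 :: "index \<Rightarrow> cls \<Rightarrow> nat \<times> nat" where
  "sign_G21 I0 K1 = (2, 0)"
| "sign_G21 I0 K2 = (1, 0)"
| "sign_G21 I0 K3 = (1, 0)"
| "sign_G21 I0 K4 = (1, 0)"
| "sign_G21 I0 K6 = (1, 0)"
| "sign_G21 I0 Kb6 = (0, 1)"
| "sign_G21 I0 Kb4 = (0, 1)"
| "sign_G21 I0 Kb3 = (0, 1)"
| "sign_G21 I0 Kb2 = (0, 1)"
| "sign_G21 I0 Kb1 = (0, 2)"
| "sign_G21 I0 K0 = (1, 1)"
| "sign_G21 I1 K1 = (0, 1)"
| "sign_G21 I1 K2 = (1, 0)"
| "sign_G21 I1 K4 = (0, 1)"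
| "sign_G21 I1 K5 = (1, 0)"
| "sign_G21 I1 K6 = (0, 2)"
| "sign_G21 I1 K7 = (1, 1)"
| "sign_G21 I1 Kb6 = (2, 0)"
| "sign_G21 I1 Kb5 = (0, 1)"
| "sign_G21 I1 Kb4 = (1, 0)"
| "sign_G21 I1 Kb2 = (0, 1)"
| "sign_G21 I1 Kb1 = (1, 0)"
| "sign_G21 I2 K2 = (0, 3)"
| "sign_G21 I2 K3 = (1, 2)"
| "sign_G21 I2 K4 = (2, 1)"
| "sign_G21 I2 K6 = (3, 0)"
| "sign_G21 I2 K5 = (0, 2)"
| "sign_G21 I2 Kb7 = (1, 1)"
| "sign_G21 I2 Kb5 = (2, 0)"
| "sign_G21 I2 Kb6 = (0, 3)"
| "sign_G21 I2 Kb4 = (1, 2)"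
| "sign_G21 I2 Kb3 = (2, 1)"
| "sign_G21 I2 Kb2 = (3, 0)"
| "sign_G21 _ _ = (0, 0)"

fun sign_of :: "cartan_type \<Rightarrow> index \<Rightarrow> cls \<Rightarrow> nat \<times> nat" where
  "sign_of D43 i c = sign_D43 i c"
| "sign_of G21 i c = sign_G21 i c"

section \<open>Energy function\<close>

definition zero_D43 :: "(cls \<times> cls) set" where
  "zero_D43 = {(Kphi, Kphi), (K2, Kb2)} \<union> {K0, K1, K2, K3} \<times> {Kb1}
     \<union> {K1} \<times> {K0, Kb1, Kb2, Kb3}"

definition two_D43 :: "(cls \<times> cls) set" where
  "two_D43 =
    (let A1 = classes D43 - {Kphi};
         A2 = {K2, K3, K0, Kb3, Kb2};
         A3 = {K3, K0, Kb3}
     in A1 \<times> {K1} \<union> {Kb1} \<times> A1 \<union> A2 \<times> {K2} \<union> {Kb2} \<times> A2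
        \<union> A3 \<times> {K3} \<union> {Kb3} \<times> A3)"

definition zero_G21 :: "(cls \<times> cls) set" where
  "zero_G21 = {(K0, K0)}
     \<union> {K1, K2, K3, K4, K5, Kb7} \<times> {Kb1, Kb2, Kb3, Kb4, Kb5, Kb7}
     \<union> {K1} \<times> {K5, K7, Kb6}
     \<union> {K6, K7, Kb5} \<times> {Kb1}"

text \<open>Here \<open>Dm\<close> and \<open>Em\<close> are the sets written \<open>D\<^sub>m\<close> without and with a bar.\<close>

definition two_G21 :: "(cls \<times> cls) set" where
  "two_G21 =
    (let D1 = classes G21 - {K0};           E1 = D1;
         D2 = classes G21 - {K0, K1, Kb1};  E2 = D2;
         D3 = {Kb5, K6, K7, Kb6, Kb4, Kb3}; E3 = {Kb6, K5, K7, K6, K4, K3};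
         D4 = D3 - {Kb3};                   E4 = E3 - {K3};
         D5 = {Kb6};                        E5 = {K6};
         D6 = {K6, K7, Kb6};                E6 = D6
     in D1 \<times> {K1} \<union> {Kb1} \<times> E1 \<union> D2 \<times> {K2} \<union> {Kb2} \<times> E2
        \<union> D3 \<times> {K3} \<union> {Kb3} \<times> E3 \<union> D4 \<times> {K4} \<union> {Kb4} \<times> E4
        \<union> D5 \<times> {K5} \<union> {Kb5} \<times> E5 \<union> D6 \<times> {K6} \<union> {Kb6} \<times> E6)"

fun energy :: "cartan_type \<Rightarrow> cls \<Rightarrow> cls \<Rightarrow> int" where
  "energy D43 x y =
     (if (x, y) \<in> zero_D43 then 0 else if (x, y) \<in> two_D43 then 2 else 1)"
| "energy G21 x y =
     (if (x, y) \<in> zero_G21 then 0 else if (x, y) \<in> two_G21 then 2 else 1)"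

section \<open>Young walls\<close>

text \<open>
  A wall is a function \<open>Y\<close> where \<open>Y k\<close> is the column \<open>y\<^sub>k\<close>, counted from the right.
  Ground-state columns are only meant for \<open>\<Lambda>\<^sub>0\<close> in type \<open>D43\<close> and for \<open>\<Lambda>\<^sub>0\<close>, \<open>\<Lambda>\<^sub>2\<close> in
  type \<open>G21\<close>.
\<close>

type_synonym wall = "nat \<Rightarrow> block set"

fun ground_column :: "cartan_type \<Rightarrow> weight \<Rightarrow> block set" where
  "ground_column D43 \<Lambda> = lower_blocks D43 0 \<union> {(bW, 0), (bQ, 0), (bZ, 1)}"
| "ground_column G21 \<Lambda> =
     (if \<Lambda> = fund_weight I0
      then lower_blocks G21 0 \<union> {(bA, 0), (bB, 0), (bX, 0), (bZ, 1)}
      else lower_blocks G21 1 \<union> {(bZ, 1), (bA, 1), (bY, 1), (bV, 1)})"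

definition young_walls :: "cartan_type \<Rightarrow> weight \<Rightarrow> wall set" where
  "young_walls T \<Lambda> = {Y.
     (\<forall>k. Y k \<in> young_columns T) \<and>
     (\<forall>k. ground_column T \<Lambda> \<subseteq> Y k) \<and>
     (\<exists>N. \<forall>k\<ge>N. Y k = ground_column T \<Lambda>) \<and>
     (\<forall>k. Y (Suc k) \<subseteq> Y k)}"

definition zero_count :: "cartan_type \<Rightarrow> weight \<Rightarrow> block set \<Rightarrow> nat" where
  "zero_count T \<Lambda> y = card {b \<in> y - ground_column T \<Lambda>. block_colour b = I0}"

definition reduced_walls :: "cartan_type \<Rightarrow> weight \<Rightarrow> wall set" where
  "reduced_walls T \<Lambda> = {Y \<in> young_walls T \<Lambda>.
     \<forall>k. energy T (class_of T (Y (Suc k))) (class_of T (Y k))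
         + int (zero_count T \<Lambda> (Y (Suc k))) - int (zero_count T \<Lambda> (Y k)) = 0}"

section \<open>Signatures of walls\<close>

text \<open>
  A left-infinite sequence of signs is given by \<open>s\<close>, where \<open>s k\<close> is the signature of the
  \<open>k\<close>-th column from the right. The position \<open>(k, j)\<close> is the \<open>j\<close>-th sign, counted from the
  left and starting with 0, in that column.
\<close>

type_synonym sign_seq = "nat \<Rightarrow> nat \<times> nat"

fun minus_at :: "sign_seq \<Rightarrow> nat \<times> nat \<Rightarrow> bool" where
  "minus_at s (k, j) \<longleftrightarrow> j < fst (s k)"

fun plus_at :: "sign_seq \<Rightarrow> nat \<times> nat \<Rightarrow> bool" where
  "plus_at s (k, j) \<longleftrightarrow> fst (s k) \<le> j \<and> j < fst (s k) + snd (s k)"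

fun left_of :: "nat \<times> nat \<Rightarrow> nat \<times> nat \<Rightarrow> bool" where
  "left_of (k, j) (k', j') \<longleftrightarrow> k' < k \<or> (k = k' \<and> j < j')"

text \<open>
  \<open>cancels s p q\<close>: the plus at \<open>p\<close> cancels with the minus at \<open>q\<close>, i.e. all signs
  between \<open>p\<close> and \<open>q\<close> have already been cancelled in pairs among themselves. The pairs
  are described by position because cancellation one pair after the other never
  ends when the ground-state column has signature \<open>(1, 1)\<close>.
\<close>

inductive cancels :: "sign_seq \<Rightarrow> nat \<times> nat \<Rightarrow> nat \<times> nat \<Rightarrow> bool" for s where
  "\<lbrakk>plus_at s p; minus_at s q; left_of p q;
    \<forall>r. (plus_at s r \<or> minus_at s r) \<and> left_of p r \<and> left_of r q \<longrightarrow>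
      (\<exists>r'. left_of p r' \<and> left_of r' q \<and> (cancels s r r' \<or> cancels s r' r))\<rbrakk>
   \<Longrightarrow> cancels s p q"

definition remaining_minus :: "sign_seq \<Rightarrow> (nat \<times> nat) set" where
  "remaining_minus s = {q. minus_at s q \<and> \<not> (\<exists>p. cancels s p q)}"

definition remaining_plus :: "sign_seq \<Rightarrow> (nat \<times> nat) set" where
  "remaining_plus s = {p. plus_at s p \<and> \<not> (\<exists>q. cancels s p q)}"

definition wall_signs :: "cartan_type \<Rightarrow> index \<Rightarrow> wall \<Rightarrow> sign_seq" where
  "wall_signs T i Y = (\<lambda>k. sign_of T i (class_of T (Y k)))"

section \<open>Operators on walls\<close>

text \<open>
  \<open>adds_block T i y y'\<close>: the Young column \<open>y'\<close> arises from \<open>y\<close> by adding an \<open>i\<close>-block.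
  The last conjunct is the convention on 2-blocks and the class \<open>c'\<^sub>7\<close>.
\<close>

definition adds_block :: "cartan_type \<Rightarrow> index \<Rightarrow> block set \<Rightarrow> block set \<Rightarrow> bool" where
  "adds_block T i y y' \<longleftrightarrow>
     y \<in> young_columns T \<and> y' \<in> young_columns T \<and>
     (\<exists>b. b \<notin> y \<and> block_colour b = i \<and> y' = insert b y) \<and>
     \<not> (T = G21 \<and> i = I2 \<and> (class_of T y = K7 \<or> class_of T y' = K7))"

definition add_block :: "cartan_type \<Rightarrow> index \<Rightarrow> block set \<Rightarrow> block set" where
  "add_block T i y = (THE y'. adds_block T i y y')"

definition remove_block :: "cartan_type \<Rightarrow> index \<Rightarrow> block set \<Rightarrow> block set" where
  "remove_block T i y = (THE y'. adds_block T i y' y)"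

text \<open>
  Column numbers grow from right to left, so the right-most minus lies in the column with
  the smallest number and the left-most plus in the one with the largest.
\<close>

definition wall_E :: "cartan_type \<Rightarrow> index \<Rightarrow> wall \<Rightarrow> wall option" where
  "wall_E T i Y =
     (let M = remaining_minus (wall_signs T i Y); k = Min (fst ` M)
      in if M = {} then None else Some (Y(k := remove_block T i (Y k))))"

definition wall_F :: "cartan_type \<Rightarrow> index \<Rightarrow> wall \<Rightarrow> wall option" where
  "wall_F T i Y =
     (let M = remaining_plus (wall_signs T i Y); k = Max (fst ` M)
      in if M = {} then None else Some (Y(k := add_block T i (Y k))))"

definition wall_eps :: "cartan_type \<Rightarrow> index \<Rightarrow> wall \<Rightarrow> int" where
  "wall_eps T i Y = int (card (remaining_minus (wall_signs T i Y)))"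

definition wall_phi :: "cartan_type \<Rightarrow> index \<Rightarrow> wall \<Rightarrow> int" where
  "wall_phi T i Y = int (card (remaining_plus (wall_signs T i Y)))"

definition added_blocks :: "cartan_type \<Rightarrow> weight \<Rightarrow> index \<Rightarrow> wall \<Rightarrow> nat" where
  "added_blocks T \<Lambda> i Y =
     card {(k, b). b \<in> Y k - ground_column T \<Lambda> \<and> block_colour b = i}"

definition wall_wt :: "cartan_type \<Rightarrow> weight \<Rightarrow> wall \<Rightarrow> weight" where
  "wall_wt T \<Lambda> Y = \<Lambda> - (\<Sum>i\<in>UNIV. int (added_blocks T \<Lambda> i Y) *s simple_root T i)"

end

theory Submission
  imports Defs
begin

text \<open>
  Read an \<open>i\<close>-signature from right to left as a walk that goes up at a plus and down at a minus.
  A plus cancels with a minus to its right exactly if the walk returns to the same level and does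
  not exceed it in between, so the remaining pluses are the steps to a new record and the remaining minuses the
  last steps down from a level. The left-most remaining plus is the step that reaches the maximum
  for the first time; turning it into a minus makes it the right-most remaining minus, changes no
  other remaining sign, and this correspondence is reversible. Hence \<open>F\<^sub>i\<close> and \<open>E\<^sub>i\<close> are described by
  one and the same relation between walls. At the chosen column the two neighbouring columns
  satisfy the inequalities of the tensor product rule, and a finite check shows that then the
  energy function follows the number of 0-blocks. A second finite check shows that the equation
  between energy and numbers of 0-blocks forces the inclusion of adjacent columns, so
  that reduced walls stay Young walls.
\<close>

section \<open>Words and heights\<close>

text \<open>The walk of a wall never comes to rest: a far ground-state column with signature (1, 1)
  sends it up and down again for ever, so cancellation has no last round and the walk no final
  height. The greatest height that recurs infinitely often takes its place. If \<open>t\<close> is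
  the number of pluses of the ground-state column and \<open>A\<close> the height at which the walk
  enters every far column, this height is \<open>A + t\<close>. Here \<open>t\<close> is the pairing
  of \<open>h_i\<close> with \<Lambda>, and \<open>A\<close> is minus the sum over \<open>j\<close>
  of \<open>a_ij\<close> times the number of added \<open>j\<close>-blocks, so \<open>A + t\<close>
  is the pairing of \<open>h_i\<close> with the weight of the wall. Columns are infinite sets with
  an integer index, yet every check runs over pairs of classes only. The reason is that one period
  of the pattern holds exactly one 0-block: once the classes are known, the number of 0-blocks, and
  likewise the energy equation, determines the relative index of two columns.\<close>

definition ht :: "(nat \<Rightarrow> int) \<Rightarrow> nat \<Rightarrow> int" where
  "ht w n = (\<Sum>m<n. w m)"

definition steps :: "(nat \<Rightarrow> int) \<Rightarrow> bool" where
  "steps w \<longleftrightarrow> (\<forall>n. w n \<in> {-1, 0, 1})"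

lemma ht_0 [simp]: "ht w 0 = 0"
  by (simp add: ht_def)

lemma ht_Suc [simp]: "ht w (Suc n) = ht w n + w n"
  by (simp add: ht_def)

text \<open>Discrete intermediate value: unit steps cannot jump over \<open>v\<close>, so the least
  point above \<open>v\<close> is entered from height exactly \<open>v\<close>.\<close>

lemma first_up:
  assumes "steps w" "m \<le> n" "ht w m \<le> v" "v < ht w n"
  obtains p where "m \<le> p" "p < n" "w p = 1" "ht w p = v" "\<And>x. m \<le> x \<Longrightarrow> x \<le> p \<Longrightarrow> ht w x \<le> v"
proof -
  define P where "P x \<longleftrightarrow> m \<le> x \<and> v < ht w x" for x
  define x where "x = (LEAST x. P x)"
  have "P n" using assms by (simp add: P_def)
  then have x: "P x" "x \<le> n" and l: "\<And>y. y < x \<Longrightarrow> \<not> P y"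
    unfolding x_def by (auto intro: LeastI Least_le dest: not_less_Least)
  have "x \<noteq> m" using x(1) assms(3) by (auto simp: P_def)
  then obtain p where p: "x = Suc p" "m \<le> p"
    using x(1) by (cases x) (auto simp: P_def)
  have le: "ht w y \<le> v" if "m \<le> y" "y \<le> p" for y
    using l[of y] that p by (auto simp: P_def)
  have "w p \<in> {-1, 0, 1}" using assms(1) by (simp add: steps_def)
  then have "w p = 1 \<and> ht w p = v"
    using le[of p] x(1) p by (auto simp: P_def)
  then show ?thesis using that[of p] p x(2) le by auto
qed

lemma last_down:
  assumes "steps w" "m \<le> n" "v < ht w m" "ht w n \<le> v"
  obtains q where "m \<le> q" "q < n" "w q = -1" "ht w (Suc q) = v"
    "\<And>x. q < x \<Longrightarrow> x \<le> n \<Longrightarrow> ht w x \<le> v"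
proof -
  define S where "S = {x. m \<le> x \<and> x \<le> n \<and> v < ht w x}"
  have fin: "finite S" and "m \<in> S"
    using assms by (auto simp: S_def)
  define q where "q = Max S"
  have q: "q \<in> S" and g: "\<And>y. y \<in> S \<Longrightarrow> y \<le> q"
    using fin \<open>m \<in> S\<close> unfolding q_def by (metis Max_in empty_iff) (use fin in simp)
  have "q \<noteq> n" using q assms(4) by (auto simp: S_def)
  then have qn: "m \<le> q" "q < n" using q by (auto simp: S_def)
  have le: "ht w y \<le> v" if "q < y" "y \<le> n" for y
    using g[of y] that qn by (force simp: S_def not_le[symmetric])
  have "w q \<in> {-1, 0, 1}" using assms(1) by (simp add: steps_def)
  then have "w q = -1 \<and> ht w (Suc q) = v"
    using le[of "Suc q"] q qn by (auto simp: S_def)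
  then show ?thesis using that[of q] qn le by auto
qed

section \<open>Cancelling pairs in terms of heights\<close>

text \<open>Bracket matching without recursion: the walk falls at \<open>q\<close>, stays at or
  below the level reached there, and rises above it for the first time at \<open>p\<close>. The
  order is \<open>q < p\<close> because letters are numbered from the right.\<close>

definition matched :: "(nat \<Rightarrow> int) \<Rightarrow> nat \<Rightarrow> nat \<Rightarrow> bool" where
  "matched w p q \<longleftrightarrow> q < p \<and> w p = 1 \<and> w q = -1 \<and> ht w p = ht w (Suc q) \<and>
     (\<forall>m. q < m \<and> m \<le> p \<longrightarrow> ht w m \<le> ht w p)"

text \<open>The inner partners keep the walk in place. If it rose above its level after
  \<open>q\<close>, the first such rise would have a partner inside, and there the walk would
  already be too high; if it started above its final height, the last descent to that height would
  have a partner after which the walk is too high again.\<close>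

lemma matched_intro:
  assumes "steps w" "q < p" "w p = 1" "w q = -1"
    and inner: "\<And>r. q < r \<Longrightarrow> r < p \<Longrightarrow> w r \<noteq> 0 \<Longrightarrow>
      \<exists>r'. q < r' \<and> r' < p \<and> (matched w r r' \<or> matched w r' r)"
  shows "matched w p q"
proof -
  have le: "ht w m \<le> ht w (Suc q)" if m: "q < m" "m \<le> p" for m
  proof (rule ccontr)
    assume "\<not> ?thesis"
    then obtain r where r: "Suc q \<le> r" "r < m" "w r = 1" "ht w r = ht w (Suc q)"
      and max: "\<And>x. Suc q \<le> x \<Longrightarrow> x \<le> r \<Longrightarrow> ht w x \<le> ht w (Suc q)"
      using first_up[of w "Suc q" m "ht w (Suc q)"] assms(1) m by auto
    obtain r' where r': "q < r'" "matched w r r' \<or> matched w r' r"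
      using inner[of r] r m by auto
    then have "matched w r r'" using r by (auto simp: matched_def)
    then show False using max[of r'] r r' by (auto simp: matched_def)
  qed
  have "ht w (Suc q) \<le> ht w p"
  proof (rule ccontr)
    assume "\<not> ?thesis"
    then obtain r where r: "Suc q \<le> r" "r < p" "w r = -1" "ht w (Suc r) = ht w p"
      and max: "\<And>x. r < x \<Longrightarrow> x \<le> p \<Longrightarrow> ht w x \<le> ht w p"
      using last_down[of w "Suc q" p "ht w p"] assms(1,2) by auto
    obtain r' where r': "q < r'" "r' < p" "matched w r r' \<or> matched w r' r"
      using inner[of r] r by auto
    then have "matched w r' r" using r by (auto simp: matched_def)
    then show False using max[of "Suc r'"] r r' by (auto simp: matched_def)
  qed
  then show ?thesis
    using le[of p] le assms(2-4) by (fastforce simp: matched_def simp del: ht_Suc)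
qed

text \<open>A rise inside the pair starts below the common level, so the walk has come down to its
  starting height since \<open>q\<close>; a descent inside ends below that level, so the walk must
  come up again before \<open>p\<close>. These crossings are the partners.\<close>

lemma matched_inner:
  assumes "steps w" "matched w p q" "q < r" "r < p" "w r \<noteq> 0"
  shows "\<exists>r'. q < r' \<and> r' < p \<and> (matched w r r' \<or> matched w r' r)"
proof -
  have le: "\<And>m. q < m \<Longrightarrow> m \<le> p \<Longrightarrow> ht w m \<le> ht w p" and eq: "ht w p = ht w (Suc q)"
    using assms(2) by (auto simp: matched_def)
  have "w r = 1 \<or> w r = -1" using assms(1,5) by (auto simp: steps_def)
  then show ?thesis
  proof
    assume w: "w r = 1"
    then have "ht w r < ht w (Suc q)" using le[of "Suc r"] eq assms(3,4) by simp
    then obtain q' where "Suc q \<le> q'" "q' < r" "w q' = -1" "ht w (Suc q') = ht w r"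
      "\<And>x. q' < x \<Longrightarrow> x \<le> r \<Longrightarrow> ht w x \<le> ht w r"
      using last_down[of w "Suc q" r "ht w r"] assms(1,3) by auto
    then show ?thesis using w assms(4) by (intro exI[of _ q']) (auto simp: matched_def)
  next
    assume w: "w r = -1"
    have "ht w (Suc r) < ht w p"
      using le[of r] w assms(3,4) by simp
    then obtain p' where "Suc r \<le> p'" "p' < p" "w p' = 1" "ht w p' = ht w (Suc r)"
      "\<And>x. Suc r \<le> x \<Longrightarrow> x \<le> p' \<Longrightarrow> ht w x \<le> ht w (Suc r)"
      using first_up[of w "Suc r" p "ht w (Suc r)"] assms(1,4) by auto
    then show ?thesis using w assms(3) by (intro exI[of _ p']) (auto simp: matched_def)
  qed
qed

section \<open>Uncancelled letters and the effect of a flip\<close>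

definition free_plus :: "(nat \<Rightarrow> int) \<Rightarrow> nat set" where
  "free_plus w = {p. w p = 1 \<and> (\<forall>m\<le>p. ht w m \<le> ht w p)}"

definition free_minus :: "(nat \<Rightarrow> int) \<Rightarrow> nat set" where
  "free_minus w = {q. w q = -1 \<and> (\<forall>m>q. ht w m \<le> ht w (Suc q))}"

lemma free_plus_matched:
  assumes "steps w"
  shows "free_plus w = {p. w p = 1 \<and> \<not> (\<exists>q. matched w p q)}"
proof -
  have "(\<forall>m\<le>p. ht w m \<le> ht w p) \<longleftrightarrow> \<not> (\<exists>q. matched w p q)" if p: "w p = 1" for p
  proof
    assume h: "\<forall>m\<le>p. ht w m \<le> ht w p"
    show "\<not> (\<exists>q. matched w p q)"
    proof
      assume "\<exists>q. matched w p q"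
      then obtain q where "matched w p q" by blast
      with h[rule_format, of q] show False by (auto simp: matched_def)
    qed
  next
    assume h: "\<not> (\<exists>q. matched w p q)"
    show "\<forall>m\<le>p. ht w m \<le> ht w p"
    proof (intro allI impI, rule ccontr)
      fix m assume "m \<le> p" "\<not> ht w m \<le> ht w p"
      then obtain q where "m \<le> q" "q < p" "w q = -1" "ht w (Suc q) = ht w p"
        "\<And>x. q < x \<Longrightarrow> x \<le> p \<Longrightarrow> ht w x \<le> ht w p"
        using last_down[of w m p "ht w p"] assms by auto
      then have "matched w p q" using p by (auto simp: matched_def)
      with h show False by blast
    qed
  qed
  then show ?thesis by (auto simp: free_plus_def)
qed

lemma free_minus_matched:
  assumes "steps w"
  shows "free_minus w = {q. w q = -1 \<and> \<not> (\<exists>p. matched w p q)}"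
proof -
  have "(\<forall>m>q. ht w m \<le> ht w (Suc q)) \<longleftrightarrow> \<not> (\<exists>p. matched w p q)" if q: "w q = -1" for q
  proof
    assume h: "\<forall>m>q. ht w m \<le> ht w (Suc q)"
    show "\<not> (\<exists>p. matched w p q)"
    proof
      assume "\<exists>p. matched w p q"
      then obtain p where "matched w p q" by blast
      with h[rule_format, of "Suc p"] show False by (auto simp: matched_def)
    qed
  next
    assume h: "\<not> (\<exists>p. matched w p q)"
    show "\<forall>m>q. ht w m \<le> ht w (Suc q)"
    proof (intro allI impI, rule ccontr)
      fix m assume "q < m" "\<not> ht w m \<le> ht w (Suc q)"
      then obtain p where "Suc q \<le> p" "p < m" "w p = 1" "ht w p = ht w (Suc q)"
        "\<And>x. Suc q \<le> x \<Longrightarrow> x \<le> p \<Longrightarrow> ht w x \<le> ht w (Suc q)"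
        using first_up[of w "Suc q" m "ht w (Suc q)"] assms by auto
      then have "matched w p q" using q by (auto simp: matched_def)
      with h show False by blast
    qed
  qed
  then show ?thesis unfolding free_minus_def by blast
qed

text \<open>\<open>F_pos\<close> is the step that reaches the global maximum, \<open>E_pos\<close>
  the step that leaves it for good. Bounds on heights are used instead of extreme elements because a
  flip changes all later heights by the same amount.\<close>

definition F_pos :: "(nat \<Rightarrow> int) \<Rightarrow> nat \<Rightarrow> bool" where
  "F_pos w p \<longleftrightarrow> w p = 1 \<and> (\<forall>m\<le>p. ht w m \<le> ht w p) \<and> (\<forall>m>p. ht w m \<le> ht w p + 1)"

definition E_pos :: "(nat \<Rightarrow> int) \<Rightarrow> nat \<Rightarrow> bool" where
  "E_pos w q \<longleftrightarrow> w q = -1 \<and> (\<forall>m\<le>q. ht w m \<le> ht w q) \<and> (\<forall>m>q. ht w m \<le> ht w q - 1)"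

text \<open>A free plus after \<open>p\<close> would start at least at \<open>ht w p + 1\<close> and
  exceed the maximum; conversely the first rise above \<open>ht w p + 1\<close> would be a later
  free plus.\<close>

lemma F_pos_iff:
  assumes "steps w"
  shows "F_pos w p \<longleftrightarrow> p \<in> free_plus w \<and> (\<forall>p'\<in>free_plus w. p' \<le> p)"
proof
  assume F: "F_pos w p"
  have "p' \<le> p" if p': "p' \<in> free_plus w" for p'
  proof (rule ccontr)
    assume "\<not> p' \<le> p"
    then have "Suc p \<le> p'" "p < Suc p'" by auto
    then have "ht w (Suc p) \<le> ht w p'" "ht w (Suc p') \<le> ht w p + 1" "w p' = 1" "w p = 1"
      using p' F by (auto simp: free_plus_def F_pos_def simp del: ht_Suc)
    then show False by simp
  qed
  then show "p \<in> free_plus w \<and> (\<forall>p'\<in>free_plus w. p' \<le> p)"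
    using F by (auto simp: free_plus_def F_pos_def)
next
  assume h: "p \<in> free_plus w \<and> (\<forall>p'\<in>free_plus w. p' \<le> p)"
  then have p: "w p = 1" "\<And>m. m \<le> p \<Longrightarrow> ht w m \<le> ht w p" by (auto simp: free_plus_def)
  have "ht w m \<le> ht w p + 1" if m: "p < m" for m
  proof (rule ccontr)
    assume "\<not> ?thesis"
    then obtain p' where p': "Suc p \<le> p'" "w p' = 1" "ht w p' = ht w p + 1"
      "\<And>x. Suc p \<le> x \<Longrightarrow> x \<le> p' \<Longrightarrow> ht w x \<le> ht w p + 1"
      using first_up[of w "Suc p" m "ht w p + 1"] assms m p(1) by auto
    have "ht w x \<le> ht w p'" if "x \<le> p'" for x
      using p(2)[of x] p'(3) p'(4)[of x] that by (cases "x \<le> p") auto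
    then have "p' \<in> free_plus w" using p' by (auto simp: free_plus_def)
    then show False using h p'(1) by auto
  qed
  then show "F_pos w p" using p by (auto simp: F_pos_def)
qed

lemma E_pos_iff:
  assumes "steps w"
  shows "E_pos w q \<longleftrightarrow> q \<in> free_minus w \<and> (\<forall>q'\<in>free_minus w. q \<le> q')"
proof
  assume E: "E_pos w q"
  have "q \<le> q'" if q': "q' \<in> free_minus w" for q'
  proof (rule ccontr)
    assume "\<not> q \<le> q'"
    then have "q' < q" "q' \<le> q" by auto
    then have "ht w q \<le> ht w (Suc q')" "ht w q' \<le> ht w q" "w q' = -1"
      using q' E by (auto simp: free_minus_def E_pos_def simp del: ht_Suc)
    then show False by simp
  qed
  then show "q \<in> free_minus w \<and> (\<forall>q'\<in>free_minus w. q \<le> q')"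
    using E by (auto simp: free_minus_def E_pos_def)
next
  assume h: "q \<in> free_minus w \<and> (\<forall>q'\<in>free_minus w. q \<le> q')"
  then have q: "w q = -1" "\<And>m. q < m \<Longrightarrow> ht w m \<le> ht w q - 1"
    by (auto simp: free_minus_def)
  have "ht w m \<le> ht w q" if m: "m \<le> q" for m
  proof (rule ccontr)
    assume "\<not> ?thesis"
    then obtain q' where q': "q' < q" "w q' = -1" "ht w (Suc q') = ht w q"
      "\<And>x. q' < x \<Longrightarrow> x \<le> q \<Longrightarrow> ht w x \<le> ht w q"
      using last_down[of w m q "ht w q"] assms m by auto
    have "ht w x \<le> ht w (Suc q')" if "q' < x" for x
      using q(2)[of x] q'(4)[of x] that unfolding q'(3) by (cases "x \<le> q") auto
    then have "q' \<in> free_minus w" using q'(2) unfolding free_minus_def by blast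
    then show False using h q'(1) by auto
  qed
  then show "E_pos w q" using q by (auto simp: E_pos_def)
qed

lemma ht_flip:
  assumes "w p = 1"
  shows "ht (w(p := -1)) n = ht w n - (if p < n then 2 else 0)"
  using assms by (induction n) (auto simp: less_Suc_eq)

text \<open>The flip lowers every height after \<open>p\<close> by 2, which turns the bound
  \<open>ht w p + 1\<close> into \<open>ht w p - 1\<close>.\<close>

lemma E_pos_flip:
  assumes "w p = 1"
  shows "E_pos (w(p := -1)) p \<longleftrightarrow> F_pos w p"
  using assms by (auto simp: E_pos_def F_pos_def ht_flip)

text \<open>Before \<open>p\<close> no height changes. After \<open>p\<close> there is no free plus
  in either word: in the old one \<open>p\<close> is the last record, in the new one all later
  heights lie below the height at \<open>p\<close>.\<close>

lemma free_plus_flip: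
  assumes "F_pos w p"
  shows "free_plus (w(p := -1)) = free_plus w - {p}"
proof -
  have p: "w p = 1" "\<And>m. m \<le> p \<Longrightarrow> ht w m \<le> ht w p" "\<And>m. p < m \<Longrightarrow> ht w m \<le> ht w p + 1"
    using assms by (auto simp: F_pos_def)
  have "r \<in> free_plus (w(p := -1)) \<longleftrightarrow> r \<in> free_plus w - {p}" for r
  proof (cases r p rule: linorder_cases)
    case less
    then show ?thesis by (auto simp: free_plus_def ht_flip[of w p, OF p(1)])
  next
    case greater
    have "r \<notin> free_plus (w(p := -1))"
    proof
      assume "r \<in> free_plus (w(p := -1))"
      then have "ht (w(p := -1)) p \<le> ht (w(p := -1)) r"
        using greater by (auto simp: free_plus_def)
      then show False using p(3)[of r] greater by (simp add: ht_flip[of w p, OF p(1)])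
    qed
    moreover have "r \<notin> free_plus w"
    proof
      assume "r \<in> free_plus w"
      then have "w r = 1" "ht w (Suc p) \<le> ht w r"
        using greater by (auto simp: free_plus_def simp del: ht_Suc)
      then show False using p(1) p(3)[of "Suc r"] greater by simp
    qed
    ultimately show ?thesis by blast
  qed (simp add: free_plus_def)
  then show ?thesis by blast
qed

text \<open>Before \<open>p\<close> there is no free minus in either word, since the height at
  \<open>p\<close> exceeds the level to which such a step descends. After \<open>p\<close> both
  sides of every comparison drop by 2.\<close>

lemma free_minus_flip:
  assumes "F_pos w p"
  shows "free_minus (w(p := -1)) = insert p (free_minus w)"
proof -
  have p: "w p = 1" "\<And>m. m \<le> p \<Longrightarrow> ht w m \<le> ht w p" "\<And>m. p < m \<Longrightarrow> ht w m \<le> ht w p + 1"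
    using assms by (auto simp: F_pos_def)
  have "r \<in> free_minus (w(p := -1)) \<longleftrightarrow> r \<in> insert p (free_minus w)" for r
  proof (cases r p rule: linorder_cases)
    case less
    have "r \<notin> free_minus (w(p := -1))"
    proof
      assume "r \<in> free_minus (w(p := -1))"
      then have "w r = -1" "ht (w(p := -1)) p \<le> ht (w(p := -1)) (Suc r)"
        using less by (auto simp: free_minus_def simp del: ht_Suc)
      then show False using p(2)[of r] less by (simp add: ht_flip[of w p, OF p(1)])
    qed
    moreover have "r \<notin> free_minus w"
    proof
      assume "r \<in> free_minus w"
      then have "w r = -1" "ht w (Suc p) \<le> ht w (Suc r)"
        using less by (auto simp: free_minus_def simp del: ht_Suc)
      then show False using p(1) p(2)[of r] less by simp
    qed
    ultimately show ?thesis using less by blast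
  next
    case equal
    have "ht w m - 2 < ht w p" if "p < m" for m using p(3)[OF that] by simp
    then show ?thesis using equal by (auto simp: free_minus_def ht_flip[of w p, OF p(1)])
  next
    case greater
    then have "ht (w(p := -1)) m = ht w m - 2" if "r \<le> m" for m
      using that by (simp add: ht_flip[of w p, OF p(1)])
    then show ?thesis using greater by (auto simp: free_minus_def simp del: ht_Suc)
  qed
  then show ?thesis by blast
qed

text \<open>Both sets are counted by levels: the free pluses are the steps to a new record, the
  free minuses the last steps down from a level.\<close>

lemma card_free:
  assumes "steps w" and le: "\<And>n. N \<le> n \<Longrightarrow> ht w n \<le> l" and inf: "\<And>n. \<exists>m\<ge>n. ht w m = l"
  shows "finite (free_plus w)" "finite (free_minus w)"
    "int (card (free_plus w)) = int (card (free_minus w)) + l"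
proof -
  obtain N' where N': "N \<le> N'" "ht w N' = l" using inf by blast
  define M where "M = Max (ht w ` {..N'})"
  have M: "ht w n \<le> M" for n
  proof (cases "n \<le> N'")
    case False
    have "ht w N' \<le> M" unfolding M_def by (rule Max_ge) auto
    then show ?thesis using False N' le[of n] by simp
  qed (auto simp: M_def)
  have "M \<in> ht w ` {..N'}" unfolding M_def by (rule Max_in) auto
  then obtain x where x: "ht w x = M" by auto
  have M0: "0 \<le> M" "l \<le> M" using M[of 0] M[of N'] N' by auto
  have "bij_betw (ht w) (free_plus w) {0..<M}"
    unfolding bij_betw_def
  proof
    show "inj_on (ht w) (free_plus w)"
    proof (rule linorder_inj_onI)
      fix p p' assume "p < p'" "p \<in> free_plus w" "p' \<in> free_plus w"
      then have "ht w (Suc p) \<le> ht w p'" "w p = 1" by (auto simp: free_plus_def simp del: ht_Suc)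
      then show "ht w p \<noteq> ht w p'" by simp
    qed auto
    show "ht w ` free_plus w = {0..<M}"
    proof safe
      fix p assume "p \<in> free_plus w"
      then have "w p = 1" "ht w 0 \<le> ht w p" by (auto simp: free_plus_def simp del: ht_0)
      then show "ht w p \<in> {0..<M}" using M[of "Suc p"] by auto
    next
      fix v assume "v \<in> {0..<M}"
      then obtain p where "w p = 1" "ht w p = v" "\<And>x. 0 \<le> x \<Longrightarrow> x \<le> p \<Longrightarrow> ht w x \<le> v"
        using first_up[of w 0 x v] assms(1) x by auto
      then show "v \<in> ht w ` free_plus w" by (auto simp: free_plus_def)
    qed
  qed
  then have fp: "finite (free_plus w)" "card (free_plus w) = nat M"
    by (auto simp: bij_betw_finite dest: bij_betw_same_card)
  \<comment> \<open>The walk returns to \<open>l\<close> again and again, so no last descent ends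
    below \<open>l\<close>; it eventually stays at or below \<open>l\<close>, so every level from
    \<open>l\<close> up to \<open>M - 1\<close> does have one.\<close>
  have "bij_betw (\<lambda>q. ht w (Suc q)) (free_minus w) {l..<M}"
    unfolding bij_betw_def
  proof
    show "inj_on (\<lambda>q. ht w (Suc q)) (free_minus w)"
    proof (rule linorder_inj_onI)
      fix p p' assume "p < p'" "p \<in> free_minus w" "p' \<in> free_minus w"
      then have "ht w p' \<le> ht w (Suc p)" "w p' = -1" by (auto simp: free_minus_def simp del: ht_Suc)
      then show "ht w (Suc p) \<noteq> ht w (Suc p')" by simp
    qed auto
    show "(\<lambda>q. ht w (Suc q)) ` free_minus w = {l..<M}"
    proof safe
      fix q assume q: "q \<in> free_minus w"
      obtain m where "Suc q \<le> m" "ht w m = l" using inf by blast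
      then have "l \<le> ht w (Suc q)" using q by (auto simp: free_minus_def simp del: ht_Suc)
      moreover have "w q = -1" using q by (simp add: free_minus_def)
      ultimately show "ht w (Suc q) \<in> {l..<M}" using M[of q] by auto
    next
      fix v assume v: "v \<in> {l..<M}"
      obtain m where m: "max x N \<le> m" "ht w m = l" using inf by blast
      obtain q where q: "q < m" "w q = -1" "ht w (Suc q) = v"
        "\<And>y. q < y \<Longrightarrow> y \<le> m \<Longrightarrow> ht w y \<le> v"
        using last_down[of w x m v] assms(1) x m v by auto
      have "ht w y \<le> v" if "q < y" for y
        using q(4)[of y] le[of y] m v that by (cases "y \<le> m") auto
      then show "v \<in> (\<lambda>q. ht w (Suc q)) ` free_minus w"
        using q by (intro image_eqI[of _ _ q]) (auto simp: free_minus_def)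
    qed
  qed
  then have fm: "finite (free_minus w)" "card (free_minus w) = nat (M - l)"
    by (auto simp: bij_betw_finite dest: bij_betw_same_card)
  show "finite (free_plus w)" "finite (free_minus w)"
    "int (card (free_plus w)) = int (card (free_minus w)) + l"
    using fp fm M0 by auto
qed

section \<open>Signatures as words\<close>

text \<open>Columns have at most three signs, so every column gets three letters, the missing signs
  being letters 0; the word is read from right to left.\<close>

definition word :: "sign_seq \<Rightarrow> nat \<Rightarrow> int" where
  "word s n = (if 2 - n mod 3 < fst (s (n div 3)) then -1
     else if 2 - n mod 3 < fst (s (n div 3)) + snd (s (n div 3)) then 1 else 0)"

definition position :: "nat \<Rightarrow> nat \<times> nat" where
  "position n = (n div 3, 2 - n mod 3)"

text \<open>The bound under which every sign occupies one of the three letters of its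
  column.\<close>

definition short :: "sign_seq \<Rightarrow> bool" where
  "short s \<longleftrightarrow> (\<forall>k. fst (s k) + snd (s k) \<le> 3)"

lemma steps_word: "steps (word s)"
  by (auto simp: steps_def word_def)

lemma inj_position: "inj position"
proof (rule injI)
  fix m n assume "position m = position n"
  then have "m div 3 = n div 3" "2 - m mod 3 = 2 - n mod 3" by (auto simp: position_def)
  moreover have "m mod 3 < 3" "n mod 3 < 3" by auto
  ultimately have "m div 3 = n div 3" "m mod 3 = n mod 3" by linarith+
  then show "m = n" by (metis div_mult_mod_eq)
qed

lemma left_of_position: "left_of (position m) (position n) \<longleftrightarrow> n < m"
proof -
  have "m mod 3 < 3" "n mod 3 < 3" "m = 3 * (m div 3) + m mod 3" "n = 3 * (n div 3) + n mod 3" by auto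
  then show ?thesis unfolding position_def left_of.simps by linarith
qed

lemma position_surj: "j < 3 \<Longrightarrow> position (3 * k + (2 - j)) = (k, j)"
  by (simp add: position_def) presburger

lemma plus_at_position: "plus_at s (position n) \<longleftrightarrow> word s n = 1"
  by (auto simp: position_def word_def)

lemma minus_at_position: "minus_at s (position n) \<longleftrightarrow> word s n = -1"
  by (auto simp: position_def word_def)

lemma sign_at_position:
  assumes "short s" "plus_at s x \<or> minus_at s x"
  obtains n where "x = position n"
proof -
  obtain k j where x: "x = (k, j)" by fastforce
  have "fst (s k) + snd (s k) \<le> 3" using assms(1) by (simp add: short_def)
  then have "j < 3" using assms(2) x by auto
  then show ?thesis using that[of "3 * k + (2 - j)"] position_surj x by simp
qed

lemma cancels_signs: "cancels s p q \<Longrightarrow> plus_at s p \<and> minus_at s q"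
  by (induction rule: cancels.induct) auto

text \<open>Rule induction: what the rule of \<open>cancels\<close> demands of the signs in between
  is, by the induction hypothesis, the premise of \<open>matched_intro\<close>.\<close>

lemma cancels_matched:
  assumes "cancels s x y" "short s" "x = position p" "y = position q"
  shows "matched (word s) p q"
  using assms
proof (induction arbitrary: p q rule: cancels.induct)
  case (1 x y)
  show ?case
  proof (rule matched_intro)
    fix r assume r: "q < r" "r < p" "word s r \<noteq> 0"
    then have "word s r = 1 \<or> word s r = -1" using steps_word[of s] by (auto simp: steps_def)
    then obtain z where z: "left_of x z" "left_of z y"
      "(cancels s (position r) z \<and> (\<forall>p q. position r = position p \<longrightarrow> z = position q \<longrightarrow> matched (word s) p q)) \<or>
       (cancels s z (position r) \<and> (\<forall>p q. z = position p \<longrightarrow> position r = position q \<longrightarrow> matched (word s) p q))"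
      using 1 r left_of_position plus_at_position minus_at_position by (smt (verit, del_insts))
    then have "plus_at s z \<or> minus_at s z" using cancels_signs by blast
    then obtain r' where "z = position r'" using sign_at_position 1(5) by blast
    then show "\<exists>r'. q < r' \<and> r' < p \<and> (matched (word s) r r' \<or> matched (word s) r' r)"
      using z 1(6,7) left_of_position by auto
  qed (use 1 left_of_position plus_at_position minus_at_position steps_word in auto)
qed

text \<open>Since \<open>matched\<close> is not recursive, the induction is on the width
  \<open>p - q\<close>: the pairs supplied by \<open>matched_inner\<close> are strictly
  narrower.\<close>

lemma matched_cancels:
  assumes "matched (word s) p q" "short s"
  shows "cancels s (position p) (position q)"
  using assms(1)
proof (induction "p - q" arbitrary: p q rule: less_induct)
  case less
  show ?case
  proof (rule cancels.intros)
    show "\<forall>r. (plus_at s r \<or> minus_at s r) \<and> left_of (position p) r \<and> left_of r (position q) \<longrightarrow>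
        (\<exists>r'. left_of (position p) r' \<and> left_of r' (position q) \<and> (cancels s r r' \<or> cancels s r' r))"
    proof (intro allI impI)
      fix x assume x: "(plus_at s x \<or> minus_at s x) \<and> left_of (position p) x \<and> left_of x (position q)"
      then obtain r where r: "x = position r" using sign_at_position assms(2) by blast
      then have "q < r" "r < p" "word s r \<noteq> 0"
        using x left_of_position plus_at_position minus_at_position by auto
      then obtain r' where r': "q < r'" "r' < p" "matched (word s) r r' \<or> matched (word s) r' r"
        using matched_inner[OF steps_word less(2)] by blast
      have "cancels s x (position r') \<or> cancels s (position r') x"
        using r'(3)
      proof
        assume "matched (word s) r r'"
        moreover have "r - r' < p - q" using \<open>q < r\<close> \<open>r < p\<close> r' by linarith
        ultimately show ?thesis using less(1) r by blast
      next
        assume "matched (word s) r' r"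
        moreover have "r' - r < p - q" using \<open>q < r\<close> \<open>r < p\<close> r' by linarith
        ultimately show ?thesis using less(1) r by blast
      qed
      then show "\<exists>r'. left_of (position p) r' \<and> left_of r' (position q) \<and> (cancels s x r' \<or> cancels s r' x)"
        using r' left_of_position by blast
    qed
  qed (use less(2) left_of_position plus_at_position minus_at_position in \<open>auto simp: matched_def\<close>)
qed

lemma cancels_position:
  "short s \<Longrightarrow> cancels s (position p) (position q) \<longleftrightarrow> matched (word s) p q"
  using cancels_matched matched_cancels by blast

lemma remaining_plus_eq:
  assumes "short s"
  shows "remaining_plus s = position ` free_plus (word s)"
proof (intro subset_antisym subsetI)
  fix x assume h: "x \<in> remaining_plus s"
  then obtain n where n: "x = position n"
    using sign_at_position assms unfolding remaining_plus_def by blast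
  then have "n \<in> free_plus (word s)"
    using h cancels_position[OF assms] plus_at_position
    unfolding free_plus_matched[OF steps_word] remaining_plus_def n by blast
  then show "x \<in> position ` free_plus (word s)" using n by auto
next
  fix x assume "x \<in> position ` free_plus (word s)"
  then obtain n where x: "x = position n" and n: "n \<in> free_plus (word s)" by blast
  show "x \<in> remaining_plus s"
    unfolding remaining_plus_def x
  proof (intro CollectI conjI notI)
    show "plus_at s (position n)" using n plus_at_position by (auto simp: free_plus_def)
    assume "\<exists>q. cancels s (position n) q"
    then obtain q where q: "cancels s (position n) q" by blast
    then obtain m where "q = position m" using cancels_signs sign_at_position assms by blast
    then show False using q n cancels_position[OF assms] unfolding free_plus_matched[OF steps_word] by auto
  qed
qed

lemma remaining_minus_eq:
  assumes "short s"
  shows "remaining_minus s = position ` free_minus (word s)"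
proof (intro subset_antisym subsetI)
  fix x assume h: "x \<in> remaining_minus s"
  then obtain n where n: "x = position n"
    using sign_at_position assms unfolding remaining_minus_def by blast
  then have "n \<in> free_minus (word s)"
    using h cancels_position[OF assms] minus_at_position
    unfolding free_minus_matched[OF steps_word] remaining_minus_def n by blast
  then show "x \<in> position ` free_minus (word s)" using n by auto
next
  fix x assume "x \<in> position ` free_minus (word s)"
  then obtain n where x: "x = position n" and n: "n \<in> free_minus (word s)" by blast
  show "x \<in> remaining_minus s"
    unfolding remaining_minus_def x
  proof (intro CollectI conjI notI)
    show "minus_at s (position n)" using n minus_at_position by (auto simp: free_minus_def)
    assume "\<exists>p. cancels s p (position n)"
    then obtain q where q: "cancels s q (position n)" by blast
    then obtain m where "q = position m" using cancels_signs sign_at_position assms by blast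
    then show False using q n cancels_position[OF assms] unfolding free_minus_matched[OF steps_word] by auto
  qed
qed

lemma fst_position [simp]: "fst (position n) = n div 3"
  by (simp add: position_def)

text \<open>The column number \<open>n div 3\<close> is monotone in the letter, so the extreme free
  letter lies in the extreme column.\<close>

lemma Max_remaining_plus:
  assumes "short s" "finite (free_plus (word s))" "F_pos (word s) p"
  shows "Max (fst ` remaining_plus s) = p div 3"
  using assms unfolding remaining_plus_eq[OF assms(1)] F_pos_iff[OF steps_word]
  by (intro Max_eqI) (auto simp: image_image div_le_mono)

lemma Min_remaining_minus:
  assumes "short s" "finite (free_minus (word s))" "E_pos (word s) p"
  shows "Min (fst ` remaining_minus s) = p div 3"
  using assms unfolding remaining_minus_eq[OF assms(1)] E_pos_iff[OF steps_word]
  by (intro Min_eqI) (auto simp: image_image div_le_mono)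

lemma F_pos_exists:
  assumes "finite (free_plus (word s))" "free_plus (word s) \<noteq> {}"
  shows "\<exists>p. F_pos (word s) p"
  using assms by (intro exI[of _ "Max (free_plus (word s))"]) (simp add: F_pos_iff[OF steps_word])

lemma E_pos_exists:
  assumes "finite (free_minus (word s))" "free_minus (word s) \<noteq> {}"
  shows "\<exists>p. E_pos (word s) p"
  using assms by (intro exI[of _ "Min (free_minus (word s))"]) (simp add: E_pos_iff[OF steps_word])

section \<open>Heights along one column\<close>

lemma word_column:
  "word s (3 * k) = (if 2 < fst (s k) then -1 else if 2 < fst (s k) + snd (s k) then 1 else 0)"
  "word s (3 * k + 1) = (if 1 < fst (s k) then -1 else if 1 < fst (s k) + snd (s k) then 1 else 0)"
  "word s (3 * k + 2) = (if 0 < fst (s k) then -1 else if 0 < fst (s k) + snd (s k) then 1 else 0)"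
proof -
  have "(3 * k + 1) div 3 = k" "(3 * k + 2) div 3 = k" "(3 * k + 1) mod 3 = 1" "(3 * k + 2) mod 3 = 2"
    by presburger+
  then show
    "word s (3 * k) = (if 2 < fst (s k) then -1 else if 2 < fst (s k) + snd (s k) then 1 else 0)"
    "word s (3 * k + 1) = (if 1 < fst (s k) then -1 else if 1 < fst (s k) + snd (s k) then 1 else 0)"
    "word s (3 * k + 2) = (if 0 < fst (s k) then -1 else if 0 < fst (s k) + snd (s k) then 1 else 0)"
    unfolding word_def by (simp_all del: One_nat_def)
qed

lemma ht_column:
  "ht w (3 * k + 1) = ht w (3 * k) + w (3 * k)"
  "ht w (3 * k + 2) = ht w (3 * k) + w (3 * k) + w (3 * k + 1)"
  "ht w (3 * k + 3) = ht w (3 * k) + w (3 * k) + w (3 * k + 1) + w (3 * k + 2)"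
  by (simp_all add: numeral_2_eq_2 numeral_3_eq_3)

text \<open>In each column the missing signs and the pluses are read before the minuses, and
  \<open>j\<close> is the number of minuses still unread. Thus \<open>j = fst (s k)\<close> gives
  the peak of the column and \<open>j = 0\<close> its end.\<close>

lemma ht_plus_end:
  assumes "short s" "j \<le> fst (s k)"
  shows "ht (word s) (3 * k + (3 - j)) = ht (word s) (3 * k) + int (snd (s k)) - int (fst (s k)) + int j"
  using assms(2)
proof (induction j)
  case 0
  have "fst (s k) + snd (s k) \<le> 3" using assms(1) by (simp add: short_def)
  then show ?case unfolding diff_zero ht_column word_column by auto
next
  case (Suc j)
  then have b: "j < fst (s k)" "j < 3" using assms(1) unfolding short_def
    by (auto dest!: spec[of _ k])
  then have "word s (3 * k + (2 - j)) = -1"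
    using minus_at_position[of s "3 * k + (2 - j)"] position_surj[of j k] by simp
  moreover have "3 * k + (3 - j) = Suc (3 * k + (2 - j))" "3 - Suc j = 2 - j" using b by auto
  ultimately show ?case using Suc by simp
qed

lemma ht_column_le:
  assumes "short s"
  shows "ht (word s) n \<le> ht (word s) (3 * (n div 3)) + int (snd (s (n div 3)))"
proof -
  define k where "k = n div 3"
  have b: "fst (s k) + snd (s k) \<le> 3" using assms by (simp add: short_def)
  have "n = 3 * k + n mod 3" "n mod 3 < 3" by (simp_all add: k_def)
  then have "n = 3 * k \<or> n = 3 * k + 1 \<or> n = 3 * k + 2" by linarith
  then have "ht (word s) n \<le> ht (word s) (3 * k) + int (snd (s k))"
  proof (elim disjE)
    assume n: "n = 3 * k + 1"
    show ?thesis unfolding n ht_column word_column using b by auto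
  next
    assume n: "n = 3 * k + 2"
    show ?thesis unfolding n ht_column word_column using b by auto
  qed simp
  then show ?thesis by (simp add: k_def)
qed

lemma ht_word:
  assumes "short s"
  shows "ht (word s) (3 * k) = (\<Sum>l<k. int (snd (s l)) - int (fst (s l)))"
proof (induction k)
  case (Suc k)
  have "3 * Suc k = 3 * k + (3 - 0)" by simp
  then have "ht (word s) (3 * Suc k) = ht (word s) (3 * k) + int (snd (s k)) - int (fst (s k)) + int 0"
    using ht_plus_end[OF assms, of 0 k] by (simp only:)
  then show ?case using Suc by simp
qed simp

text \<open>A column peaks just before its minuses, so the step to the global maximum is the
  left-most plus of its column. The left neighbour peaks \<open>snd (s (Suc k)) - fst (s k)\<close>
  higher, which must not be positive. The right neighbour peaks \<open>fst (s l) - snd (s k)\<close>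
  higher, which must be negative since the maximum is reached for the first time in column
  \<open>k\<close>.\<close>

lemma F_pos_column:
  assumes "short s" "F_pos (word s) p" and k: "k = p div 3"
  shows "0 < snd (s k)" "p = 3 * k + (2 - fst (s k))" "snd (s (Suc k)) \<le> fst (s k)"
    "\<And>l. k = Suc l \<Longrightarrow> fst (s l) < snd (s k)"
proof -
  let ?w = "word s" and ?r = "fst (s k)" and ?a = "snd (s k)"
  have b: "?r + ?a \<le> 3" using assms(1) by (simp add: short_def)
  have F: "?w p = 1" "\<And>m. m \<le> p \<Longrightarrow> ht ?w m \<le> ht ?w p" "\<And>m. p < m \<Longrightarrow> ht ?w m \<le> ht ?w p + 1"
    using assms(2) by (auto simp: F_pos_def)
  have pm: "p = 3 * k + p mod 3" "p mod 3 < 3" using k by auto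
  define j where "j = 2 - p mod 3"
  have j: "p = 3 * k + (2 - j)" "j < 3" using pm by (auto simp: j_def)
  have jr: "?r \<le> j" "j < ?r + ?a"
    using F(1) k by (auto simp: word_def j_def split: if_splits)
  show a: "0 < ?a" using jr by simp
  have top: "ht ?w (3 * k + (3 - ?r)) = ht ?w (3 * k) + int ?a"
    using ht_plus_end[OF assms(1), of ?r k] by simp
  have r3: "?r < 3" using a b by simp
  have "j = ?r"
  \<comment> \<open>Otherwise the next letter is a plus as well and the walk reaches
    \<open>ht ?w p + 2\<close>.\<close>
  proof (rule ccontr)
    assume "j \<noteq> ?r"
    then have "?r < j" using jr by simp
    then have "word s (3 * k + (2 - (j - 1))) = 1"
      using plus_at_position[of s "3 * k + (2 - (j - 1))"] position_surj[of "j - 1" k] jr(2) j(2) by auto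
    moreover have "3 * k + (2 - (j - 1)) = Suc p" using \<open>?r < j\<close> j by simp
    ultimately have "ht ?w (Suc (Suc p)) = ht ?w p + 2" using F(1) by simp
    then show False using F(3)[of "Suc (Suc p)"] by simp
  qed
  then show p: "p = 3 * k + (2 - ?r)" using j by simp
  have "Suc p = 3 * k + (3 - ?r)" using p r3 by simp
  then have hp: "ht ?w p = ht ?w (3 * k) + int ?a - 1"
    using top F(1) ht_Suc[of ?w p] by simp
  have e0: "ht ?w (3 * Suc k) = ht ?w (3 * k) + int ?a - int ?r"
    using ht_plus_end[OF assms(1), of 0 k] by (simp add: algebra_simps)
  have "ht ?w (3 * Suc k + (3 - fst (s (Suc k)))) = ht ?w (3 * Suc k) + int (snd (s (Suc k)))"
    using ht_plus_end[OF assms(1), of "fst (s (Suc k))" "Suc k"] by simp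
  moreover have "p < 3 * Suc k + (3 - fst (s (Suc k)))" using p by simp
  ultimately show "snd (s (Suc k)) \<le> ?r" using F(3) e0 hp by fastforce
  show "fst (s l) < ?a" if "k = Suc l" for l
  proof -
    have e: "ht ?w (3 * k) = ht ?w (3 * l) + int (snd (s l)) - int (fst (s l))"
      using ht_plus_end[OF assms(1), of 0 l] that by (simp add: algebra_simps)
    have "ht ?w (3 * l + (3 - fst (s l))) = ht ?w (3 * l) + int (snd (s l))"
      using ht_plus_end[OF assms(1), of "fst (s l)" l] by simp
    moreover have "3 * l + (3 - fst (s l)) \<le> p" using p that by simp
    ultimately show ?thesis using F(2) e hp by fastforce
  qed
qed

text \<open>The height at \<open>p\<close> is at least the peak of the column, and only the
  right-most minus starts from the peak.\<close>

lemma E_pos_column: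
  assumes "short s" "E_pos (word s) p" and k: "k = p div 3"
  shows "0 < fst (s k)" "p = 3 * k + (3 - fst (s k))"
proof -
  let ?w = "word s" and ?r = "fst (s k)" and ?a = "snd (s k)"
  have b: "?r + ?a \<le> 3" using assms(1) by (simp add: short_def)
  have E: "?w p = -1" "\<And>m. m \<le> p \<Longrightarrow> ht ?w m \<le> ht ?w p"
    using assms(2) by (auto simp: E_pos_def)
  have pm: "p = 3 * k + p mod 3" "p mod 3 < 3" using k by auto
  define j where "j = 2 - p mod 3"
  have j: "p = 3 * k + (2 - j)" "j < 3" using pm by (auto simp: j_def)
  have jr: "j < ?r"
    using E(1) k by (auto simp: word_def j_def split: if_splits)
  then show r: "0 < ?r" by simp
  have "Suc p = 3 * k + (3 - j)" using j by simp
  then have "ht ?w p - 1 = ht ?w (3 * k) + int ?a - int ?r + int j"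
    using ht_plus_end[OF assms(1), of j k] jr E(1) ht_Suc[of ?w p] by simp
  moreover have "ht ?w (3 * k + (3 - ?r)) = ht ?w (3 * k) + int ?a"
    using ht_plus_end[OF assms(1), of ?r k] by simp
  moreover have "3 * k + (3 - ?r) \<le> p" using j jr b by linarith
  ultimately have "j + 1 = ?r" using E(2)[of "3 * k + (3 - ?r)"] jr by linarith
  then show "p = 3 * k + (3 - ?r)" using j by simp
qed

text \<open>The number of signs of the column is kept, so the letters stay aligned and only that of
  the left-most plus changes.\<close>

lemma word_flip:
  assumes "short s" "0 < snd (s k)" "s' = s(k := (Suc (fst (s k)), snd (s k) - 1))"
  shows "word s' = (word s)(3 * k + (2 - fst (s k)) := -1)"
proof
  fix n
  have b: "fst (s k) + snd (s k) \<le> 3" using assms(1) by (simp add: short_def)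
  show "word s' n = ((word s)(3 * k + (2 - fst (s k)) := -1)) n"
  proof (cases "n div 3 = k")
    case False
    then have "n \<noteq> 3 * k + (2 - fst (s k))" by auto
    then show ?thesis using False by (simp add: word_def assms(3))
  next
    case True
    have m: "n = 3 * k + n mod 3" "n mod 3 < 3" using True by auto
    have "n = 3 * k + (2 - fst (s k)) \<longleftrightarrow> 2 - n mod 3 = fst (s k)"
      using m b assms(2) by linarith
    then show ?thesis using True b assms(2) by (auto simp: word_def assms(3))
  qed
qed

section \<open>Young columns\<close>

fun label_list :: "cartan_type \<Rightarrow> blabel list" where
  "label_list D43 = [bZ, bW, bP, bQ]"
| "label_list G21 = [bZ, bA, bB, bX, bY, bV]"

fun class_list :: "cartan_type \<Rightarrow> cls list" where
  "class_list D43 = [K1, K2, K3, K0, Kb3, Kb2, Kb1, Kphi]"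
| "class_list G21 = [K1, K2, K3, K4, K5, K6, K7, Kb7, Kb6, Kb5, Kb4, Kb3, Kb2, Kb1, K0]"

text \<open>The tops for index 0, as lists so that the checks can be evaluated. The last equation
  also covers the classes with empty top, \<open>Kb3\<close> in type \<open>D43\<close> and
  \<open>Kb4\<close> in type \<open>G21\<close>.\<close>

fun top_list :: "cartan_type \<Rightarrow> cls \<Rightarrow> block list" where
  "top_list D43 K1 = [(bZ, 0), (bW, 0), (bQ, 0), (bZ, 1)]"
| "top_list D43 K2 = [(bZ, 0)]"
| "top_list D43 K3 = [(bZ, 0), (bW, 0)]"
| "top_list D43 K0 = [(bZ, 0), (bW, 0), (bP, 0)]"
| "top_list D43 Kb2 = [(bW, 0)]"
| "top_list D43 Kb1 = [(bW, 0), (bQ, 0)]"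
| "top_list D43 Kphi = [(bW, 0), (bQ, 0), (bZ, 1)]"
| "top_list G21 K1 = [(bZ, 0), (bA, 0), (bB, 0), (bX, 0), (bZ, 1)]"
| "top_list G21 K2 = [(bZ, 0), (bA, 0), (bB, 0), (bX, 0), (bY, 0), (bZ, 1)]"
| "top_list G21 K3 = [(bZ, 0)]"
| "top_list G21 K4 = [(bZ, 0), (bA, 0)]"
| "top_list G21 K5 = [(bZ, 0), (bA, 0), (bY, 0)]"
| "top_list G21 K6 = [(bZ, 0), (bA, 0), (bB, 0)]"
| "top_list G21 K7 = [(bZ, 0), (bA, 0), (bB, 0), (bY, 0)]"
| "top_list G21 Kb7 = [(bZ, 0), (bA, 0), (bY, 0), (bV, 0)]"
| "top_list G21 Kb6 = [(bZ, 0), (bA, 0), (bB, 0), (bY, 0), (bX, 0)]"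
| "top_list G21 Kb5 = [(bZ, 0), (bA, 0), (bB, 0), (bY, 0), (bV, 0)]"
| "top_list G21 Kb3 = [(bA, 0)]"
| "top_list G21 Kb2 = [(bA, 0), (bB, 0)]"
| "top_list G21 Kb1 = [(bA, 0), (bB, 0), (bX, 0)]"
| "top_list G21 K0 = [(bA, 0), (bB, 0), (bX, 0), (bZ, 1)]"
| "top_list _ _ = []"

definition in_class :: "cartan_type \<Rightarrow> cls \<Rightarrow> blabel \<Rightarrow> int \<Rightarrow> bool" where
  "in_class T c l d \<longleftrightarrow> d < 0 \<or> List.member (top_list T c) (l, d)"

lemma set_label_list: "set (label_list T) = labels T"
  by (cases T) auto

lemma set_class_list: "set (class_list T) = classes T"
  by (cases T) auto

lemma lower_blocks_iff: "b \<in> lower_blocks T n \<longleftrightarrow> fst b \<in> labels T \<and> snd b < n"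
  by (cases b) (auto simp: lower_blocks_def)

lemma column_of_iff:
  assumes "c \<in> classes T"
  shows "b \<in> column_of T c n \<longleftrightarrow> fst b \<in> labels T \<and> in_class T c (fst b) (snd b - n)"
proof (cases T)
  case D43
  show ?thesis
    using assms unfolding D43
    by (cases b; simp only: classes.simps; elim insertE emptyE)
      (auto simp: lower_blocks_iff in_class_def)
next
  case G21
  show ?thesis
    using assms unfolding G21
    by (cases b; simp only: classes.simps; elim insertE emptyE)
      (auto simp: lower_blocks_iff in_class_def)
qed

section \<open>Counting the blocks of one colour\<close>

text \<open>The number of blocks of each colour in one period of the pattern; these are the
  coefficients of the null root in the simple roots.\<close>

fun period :: "cartan_type \<Rightarrow> index \<Rightarrow> int" where
  "period D43 I0 = 1" | "period D43 I1 = 2" | "period D43 I2 = 1"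
| "period G21 I0 = 1" | "period G21 I1 = 2" | "period G21 I2 = 3"

definition top_count :: "cartan_type \<Rightarrow> cls \<Rightarrow> index \<Rightarrow> int" where
  "top_count T c j = int (length (filter (\<lambda>b. block_colour b = j) (top_list T c)))"

lemma top_list_window:
  "b \<in> set (top_list T c) \<Longrightarrow> fst b \<in> labels T \<and> (snd b = 0 \<or> snd b = 1)"
  by (induction T c rule: top_list.induct) auto

lemma distinct_top_list: "distinct (top_list T c)"
  by (induction T c rule: top_list.induct) auto

lemma in_class_low: "d < 0 \<Longrightarrow> in_class T c l d"
  by (simp add: in_class_def)

lemma in_class_high: "2 \<le> d \<Longrightarrow> \<not> in_class T c l d"
  by (auto simp: in_class_def List.member_iff dest: top_list_window)

lemma block_colour_shift: "block_colour (l, n) = block_colour (l, m)"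
  by simp

lemma card_labels: "card {l \<in> labels T. block_colour (l, 0) = j} = nat (period T j)"
proof -
  have "{l \<in> labels T. block_colour (l, 0) = j} = set (filter (\<lambda>l. block_colour (l, 0) = j) (label_list T))"
    by (simp add: set_label_list)
  then show ?thesis
    by (simp only:) (cases T; cases j; simp)
qed

text \<open>A column contains infinitely many blocks; this is its number of \<open>j\<close>-blocks,
  normalised to 0 for \<open>lower_blocks T 0\<close>.\<close>

definition height :: "cartan_type \<Rightarrow> index \<Rightarrow> cls \<Rightarrow> int \<Rightarrow> int" where
  "height T j c n = top_count T c j + period T j * n"

lemma period_pos: "0 \<le> period T j"
  by (cases T; cases j) auto

text \<open>Above the cut \<open>L\<close> a column is a full rectangle of labels and indices up to
  \<open>n\<close>, plus its shifted top.\<close>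

lemma card_column:
  fixes j :: index
  assumes "c \<in> classes T" "L \<le> n"
  defines "S \<equiv> {b \<in> column_of T c n. block_colour b = j \<and> L \<le> snd b}"
  shows "finite S" "int (card S) = height T j c n - period T j * L"
proof -
  let ?A = "{l \<in> labels T. block_colour (l, 0) = j} \<times> {L..<n}"
  let ?B = "(\<lambda>b. (fst b, snd b + n)) ` set (filter (\<lambda>b. block_colour b = j) (top_list T c))"
  have S: "S = ?A \<union> ?B"
  proof (intro set_eqI)
    fix b :: block
    obtain l m where b: "b = (l, m)" by fastforce
    have "(l, m) \<in> ?B \<longleftrightarrow> block_colour (l, m) = j \<and> (l, m - n) \<in> set (top_list T c)"
      by (force simp: image_iff)
    then show "b \<in> S \<longleftrightarrow> b \<in> ?A \<union> ?B"
      using assms(2) top_list_window[of "(l, m - n)" T c]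
      unfolding b S_def
      by (auto simp: column_of_iff[OF assms(1)] in_class_def List.member_iff
          simp del: block_colour.simps intro: block_colour_shift)
  qed
  have fl: "finite (labels T)" by (metis finite_set set_label_list)
  have A: "finite ?A" "int (card ?A) = period T j * (n - L)"
    using fl assms(2) period_pos[of T j] by (auto simp: card_cartesian_product card_labels simp del: block_colour.simps)
  have "inj_on (\<lambda>b. (fst b, snd b + n)) (set (filter (\<lambda>b. block_colour b = j) (top_list T c)))"
    by (auto simp: inj_on_def)
  then have B: "finite ?B" "int (card ?B) = top_count T c j"
    by (simp_all add: card_image top_count_def distinct_card distinct_top_list del: set_filter)
  have "?A \<inter> ?B = {}" by (auto dest: top_list_window)
  then have "int (card S) = period T j * (n - L) + top_count T c j"
    using A B by (simp add: S card_Un_disjoint)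
  then show "finite S" "int (card S) = height T j c n - period T j * L"
    using A B by (auto simp: S height_def algebra_simps)
qed

lemma column_diff:
  fixes j :: index
  assumes "c \<in> classes T" "c' \<in> classes T" "column_of T c n \<subseteq> column_of T c' n'"
  defines "S \<equiv> {b \<in> column_of T c' n' - column_of T c n. block_colour b = j}"
  shows "finite S" "int (card S) = height T j c' n' - height T j c n"
proof -
  \<comment> \<open>Below the smaller index both columns are full, so cutting there loses nothing of
    the difference.\<close>
  define L where "L = min n n'"
  let ?C = "{b \<in> column_of T c n. block_colour b = j \<and> L \<le> snd b}"
  let ?C' = "{b \<in> column_of T c' n'. block_colour b = j \<and> L \<le> snd b}"
  have C: "finite ?C" "int (card ?C) = height T j c n - period T j * L"
    using card_column[OF assms(1), of L n] by (auto simp: L_def)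
  have C': "finite ?C'" "int (card ?C') = height T j c' n' - period T j * L"
    using card_column[OF assms(2), of L n'] by (auto simp: L_def)
  have "L \<le> snd b" if "b \<in> S" for b
    using that assms(1,2) unfolding S_def
    by (auto simp: column_of_iff L_def in_class_def)
  then have "S = ?C' - ?C" unfolding S_def by auto
  moreover have "?C \<subseteq> ?C'" using assms(3) by auto
  ultimately show "finite S" "int (card S) = height T j c' n' - height T j c n"
    using C C' card_Diff_subset[of ?C ?C'] card_mono[of ?C' ?C] by (auto simp: of_nat_diff)
qed

text \<open>The blocks that a column of class \<open>c'\<close> shifted up by \<open>e\<close> has and the unshifted column of class
  \<open>c\<close> lacks; the list of offsets is complete for \<open>e \<le> 3\<close>.\<close>

definition gained :: "cartan_type \<Rightarrow> cls \<Rightarrow> cls \<Rightarrow> int \<Rightarrow> block list" where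
  "gained T c c' e =
     filter (\<lambda>(l, d). in_class T c' l (d - e) \<and> \<not> in_class T c l d)
       (List.product (label_list T) [0, 1, 2, 3, 4])"

lemma column_gain:
  assumes "c \<in> classes T" "c' \<in> classes T" "n' - n \<le> 3"
  shows "column_of T c' n' - column_of T c n = (\<lambda>(l, d). (l, n + d)) ` set (gained T c c' (n' - n))"
proof (intro set_eqI)
  fix b :: block
  obtain l m where b: "b = (l, m)" by fastforce
  have "b \<in> (\<lambda>(l, d). (l, n + d)) ` set (gained T c c' (n' - n)) \<longleftrightarrow> (l, m - n) \<in> set (gained T c c' (n' - n))"
    unfolding b by (force simp: image_iff)
  also have "\<dots> \<longleftrightarrow> l \<in> labels T \<and> m - n \<in> {0, 1, 2, 3, 4} \<and> in_class T c' l (m - n') \<and> \<not> in_class T c l (m - n)"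
    by (auto simp: gained_def set_label_list)
  also have "\<dots> \<longleftrightarrow> l \<in> labels T \<and> in_class T c' l (m - n') \<and> \<not> in_class T c l (m - n)"
  proof -
    \<comment> \<open>Tops use offsets 0 and 1 only, so relative to \<open>n\<close> the offset is
      at most 1 + 3.\<close>
    have "m - n \<in> {0, 1, 2, 3, 4}" if "in_class T c' l (m - n')" "\<not> in_class T c l (m - n)"
    proof -
      have "0 \<le> m - n" using in_class_low[of "m - n" T c l] that(2) by linarith
      moreover have "m - n' < 2" using in_class_high[of "m - n'" T c' l] that(1) by linarith
      ultimately show ?thesis using assms(3) by auto
    qed
    then show ?thesis by blast
  qed
  finally show "b \<in> column_of T c' n' - column_of T c n \<longleftrightarrow>
      b \<in> (\<lambda>(l, d). (l, n + d)) ` set (gained T c c' (n' - n))"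
    using assms(1,2) by (auto simp: b column_of_iff)
qed

section \<open>Tables of arrows and finite checks\<close>

text \<open>The arrows between classes, with the increase of the index. The increase is 1 exactly
  where the new block completes rows \<open>2n\<close> and \<open>2n + 1\<close>, so that the rest
  is read as a top over \<open>J\<close> of the next index.\<close>

fun up_list :: "cartan_type \<Rightarrow> ((index \<times> cls) \<times> cls \<times> int) list" where
  "up_list D43 =
    [((I0, Kb3), K2, 0), ((I0, Kb2), K3, 0), ((I0, Kb1), Kphi, 0), ((I0, Kphi), K1, 0),
     ((I1, K1), K2, 1), ((I1, K3), K0, 0), ((I1, K0), Kb3, 1), ((I1, Kb2), Kb1, 0),
     ((I2, K2), K3, 0), ((I2, Kb3), Kb2, 0)]"
| "up_list G21 =
    [((I0, Kb6), K2, 0), ((I0, Kb4), K3, 0), ((I0, Kb3), K4, 0), ((I0, Kb2), K6, 0),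
     ((I0, Kb1), K0, 0), ((I0, K0), K1, 0), ((I1, K1), K2, 0), ((I1, K4), K5, 0),
     ((I1, K6), K7, 0), ((I1, K7), Kb6, 0), ((I1, Kb5), Kb4, 1), ((I1, Kb2), Kb1, 0),
     ((I2, K2), K3, 1), ((I2, K3), K4, 0), ((I2, K4), K6, 0), ((I2, K5), Kb7, 0),
     ((I2, Kb7), Kb5, 0), ((I2, Kb6), Kb4, 1), ((I2, Kb4), Kb3, 0), ((I2, Kb3), Kb2, 0)]"

definition up :: "cartan_type \<Rightarrow> index \<Rightarrow> cls \<Rightarrow> (cls \<times> int) option" where
  "up T i c = map_of (up_list T) (i, c)"

text \<open>Without this exclusion 2-blocks could be placed in two ways: \<open>B\<close> and
  \<open>V\<close> both fit on class \<open>K5\<close>, leading to \<open>K7\<close> and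
  \<open>Kb7\<close>, and \<open>Kb5\<close> could be reached from both of these.\<close>

definition K7_step :: "cartan_type \<Rightarrow> index \<Rightarrow> cls \<Rightarrow> cls \<Rightarrow> bool" where
  "K7_step T i c c' \<longleftrightarrow> T = G21 \<and> i = I2 \<and> (c = K7 \<or> c' = K7)"

text \<open>The relative index at which columns of the two classes have equally many 0-blocks, as
  \<open>period T I0\<close> is 1. This is why \<open>counts_match\<close> compares only the colours
  \<open>I1\<close> and \<open>I2\<close>.\<close>

definition zero_diff :: "cartan_type \<Rightarrow> cls \<Rightarrow> cls \<Rightarrow> int" where
  "zero_diff T c c' = top_count T c I0 - top_count T c' I0"

definition counts_match :: "cartan_type \<Rightarrow> cls \<Rightarrow> cls \<Rightarrow> int \<Rightarrow> index option \<Rightarrow> bool" where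
  "counts_match T c c' e i \<longleftrightarrow>
     list_all (\<lambda>j. top_count T c' j + period T j * e = top_count T c j + (if i = Some j then 1 else 0)) [I1, I2]"

text \<open>The checks below use \<open>if\<close> in place of an implication because the simplifier, which
  evaluates them, would otherwise evaluate the conclusion also where the premise is false.\<close>

definition check_up :: "cartan_type \<Rightarrow> bool" where
  "check_up T \<longleftrightarrow> list_all (\<lambda>c. list_all (\<lambda>c'. list_all (\<lambda>i.
     (let e = zero_diff T c c' + (if i = I0 then 1 else 0) in
      if counts_match T c c' e (Some i) then
        if gained T c' c (- e) = [] then if K7_step T i c c' then True else up T i c = Some (c', e) else True
      else True))
     [I0, I1, I2]) (class_list T)) (class_list T)"

definition check_inj :: "cartan_type \<Rightarrow> bool" where
  "check_inj T \<longleftrightarrow> list_all (\<lambda>c. list_all (\<lambda>c'.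
     (let e = zero_diff T c c' in
      if counts_match T c c' e None then if gained T c c' e = [] then c = c' \<and> e = 0 else True else True))
     (class_list T)) (class_list T)"

lemma check_up: "check_up T"
proof (cases T)
  case D43
  show ?thesis unfolding D43 by code_simp
next
  case G21
  show ?thesis unfolding G21 by code_simp
qed

lemma check_inj: "check_inj T"
proof (cases T)
  case D43
  show ?thesis unfolding D43 by code_simp
next
  case G21
  show ?thesis unfolding G21 by code_simp
qed

text \<open>This ties the signature tables to the blocks: an arrow starts exactly where there is a
  plus, it adds one block of its colour and turns a plus into a minus, and exactly one arrow ends
  where there is a minus. The list of classes with an arrow into \<open>c\<close> is measured by its
  length to get existence and uniqueness at once.\<close>

definition check_sign :: "cartan_type \<Rightarrow> bool" where
  "check_sign T \<longleftrightarrow> list_all (\<lambda>c. list_all (\<lambda>i.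
     (case up T i c of
        None \<Rightarrow> snd (sign_of T i c) = 0
      | Some (c', e) \<Rightarrow> List.member (class_list T) c' \<and> (e = 0 \<or> e = 1) \<and>
          gained T c' c (- e) = [] \<and> map block_colour (gained T c c' e) = [i] \<and>
          \<not> K7_step T i c c' \<and> 0 < snd (sign_of T i c) \<and>
          sign_of T i c' = (Suc (fst (sign_of T i c)), snd (sign_of T i c) - 1)) \<and>
     length (filter (\<lambda>b. map_option fst (up T i b) = Some c) (class_list T)) =
       (if fst (sign_of T i c) = 0 then 0 else 1) \<and>
     fst (sign_of T i c) + snd (sign_of T i c) \<le> 3)
     [I0, I1, I2]) (class_list T)"

lemma check_sign: "check_sign T"
proof (cases T)
  case D43
  show ?thesis unfolding D43 by code_simp
next
  case G21
  show ?thesis unfolding G21 by code_simp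
qed


section \<open>The energy function as a lookup table\<close>

definition energy_zero :: "cartan_type \<Rightarrow> cls \<Rightarrow> cls \<Rightarrow> bool" where
  "energy_zero T x y \<longleftrightarrow> (case T of
     D43 \<Rightarrow> x = Kphi \<and> y = Kphi \<or> x = K2 \<and> y = Kb2 \<or>
       List.member [K0, K1, K2, K3] x \<and> y = Kb1 \<or> x = K1 \<and> List.member [K0, Kb1, Kb2, Kb3] y
   | G21 \<Rightarrow> x = K0 \<and> y = K0 \<or>
       List.member [K1, K2, K3, K4, K5, Kb7] x \<and> List.member [Kb1, Kb2, Kb3, Kb4, Kb5, Kb7] y \<or>
       x = K1 \<and> List.member [K5, K7, Kb6] y \<or> List.member [K6, K7, Kb5] x \<and> y = Kb1)"

text \<open>The set of pairs of energy 2 is split by the factor that is fixed: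
  \<open>two_left\<close> treats the products with an unbarred class on the right,
  \<open>two_right\<close> those with a barred class on the left.\<close>

definition two_left :: "cartan_type \<Rightarrow> cls \<Rightarrow> cls list" where
  "two_left T y = (case T of
     D43 \<Rightarrow> (case y of
         K1 \<Rightarrow> [K1, K2, K3, K0, Kb3, Kb2, Kb1]
       | K2 \<Rightarrow> [K2, K3, K0, Kb3, Kb2]
       | K3 \<Rightarrow> [K3, K0, Kb3]
       | _ \<Rightarrow> [])
   | G21 \<Rightarrow> (case y of
         K1 \<Rightarrow> [K1, K2, K3, K4, K5, K6, K7, Kb7, Kb6, Kb5, Kb4, Kb3, Kb2, Kb1]
       | K2 \<Rightarrow> [K2, K3, K4, K5, K6, K7, Kb7, Kb6, Kb5, Kb4, Kb3, Kb2]
       | K3 \<Rightarrow> [Kb5, K6, K7, Kb6, Kb4, Kb3]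
       | K4 \<Rightarrow> [Kb5, K6, K7, Kb6, Kb4]
       | K5 \<Rightarrow> [Kb6]
       | K6 \<Rightarrow> [K6, K7, Kb6]
       | _ \<Rightarrow> []))"

definition two_right :: "cartan_type \<Rightarrow> cls \<Rightarrow> cls list" where
  "two_right T x = (case T of
     D43 \<Rightarrow> (case x of
         Kb1 \<Rightarrow> [K1, K2, K3, K0, Kb3, Kb2, Kb1]
       | Kb2 \<Rightarrow> [K2, K3, K0, Kb3, Kb2]
       | Kb3 \<Rightarrow> [K3, K0, Kb3]
       | _ \<Rightarrow> [])
   | G21 \<Rightarrow> (case x of
         Kb1 \<Rightarrow> [K1, K2, K3, K4, K5, K6, K7, Kb7, Kb6, Kb5, Kb4, Kb3, Kb2, Kb1]
       | Kb2 \<Rightarrow> [K2, K3, K4, K5, K6, K7, Kb7, Kb6, Kb5, Kb4, Kb3, Kb2]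
       | Kb3 \<Rightarrow> [Kb6, K5, K7, K6, K4, K3]
       | Kb4 \<Rightarrow> [Kb6, K5, K7, K6, K4]
       | Kb5 \<Rightarrow> [K6]
       | Kb6 \<Rightarrow> [K6, K7, Kb6]
       | _ \<Rightarrow> []))"

definition energy_exec :: "cartan_type \<Rightarrow> cls \<Rightarrow> cls \<Rightarrow> int" where
  "energy_exec T x y = (if energy_zero T x y then 0
     else if List.member (two_left T y) x then 2
     else if List.member (two_right T x) y then 2 else 1)"

lemma two_left_iff:
  "x \<in> set (two_left D43 y) \<longleftrightarrow> x \<in> classes D43 - {Kphi} \<and> y = K1 \<or>
     x \<in> {K2, K3, K0, Kb3, Kb2} \<and> y = K2 \<or> x \<in> {K3, K0, Kb3} \<and> y = K3"
  "x \<in> set (two_left G21 y) \<longleftrightarrow> x \<in> classes G21 - {K0} \<and> y = K1 \<or>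
     x \<in> classes G21 - {K0, K1, Kb1} \<and> y = K2 \<or>
     x \<in> {Kb5, K6, K7, Kb6, Kb4, Kb3} \<and> y = K3 \<or>
     x \<in> {Kb5, K6, K7, Kb6, Kb4, Kb3} - {Kb3} \<and> y = K4 \<or>
     x \<in> {Kb6} \<and> y = K5 \<or> x \<in> {K6, K7, Kb6} \<and> y = K6"
  by (cases y; simp add: two_left_def insert_Diff_if)+

lemma two_right_iff:
  "y \<in> set (two_right D43 x) \<longleftrightarrow> y \<in> classes D43 - {Kphi} \<and> x = Kb1 \<or>
     y \<in> {K2, K3, K0, Kb3, Kb2} \<and> x = Kb2 \<or> y \<in> {K3, K0, Kb3} \<and> x = Kb3"
  "y \<in> set (two_right G21 x) \<longleftrightarrow> y \<in> classes G21 - {K0} \<and> x = Kb1 \<or>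
     y \<in> classes G21 - {K0, K1, Kb1} \<and> x = Kb2 \<or>
     y \<in> {Kb6, K5, K7, K6, K4, K3} \<and> x = Kb3 \<or>
     y \<in> {Kb6, K5, K7, K6, K4, K3} - {K3} \<and> x = Kb4 \<or>
     y \<in> {K6} \<and> x = Kb5 \<or> y \<in> {K6, K7, Kb6} \<and> x = Kb6"
  by (cases x; simp add: two_right_def insert_Diff_if)+

lemma two_D43_iff: "(x, y) \<in> two_D43 \<longleftrightarrow> x \<in> set (two_left D43 y) \<or> y \<in> set (two_right D43 x)"
  unfolding two_D43_def two_left_iff two_right_iff Let_def Un_iff mem_Times_iff fst_conv snd_conv
    singleton_iff by argo

lemma two_G21_iff: "(x, y) \<in> two_G21 \<longleftrightarrow> x \<in> set (two_left G21 y) \<or> y \<in> set (two_right G21 x)"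
  unfolding two_G21_def two_left_iff two_right_iff Let_def Un_iff mem_Times_iff fst_conv snd_conv
    singleton_iff by argo

lemma zero_D43_iff: "(x, y) \<in> zero_D43 \<longleftrightarrow> energy_zero D43 x y"
  unfolding zero_D43_def energy_zero_def Un_iff mem_Times_iff fst_conv snd_conv insert_iff empty_iff
    cartan_type.case List.member_iff list.set prod.inject by argo

lemma zero_G21_iff: "(x, y) \<in> zero_G21 \<longleftrightarrow> energy_zero G21 x y"
  unfolding zero_G21_def energy_zero_def Un_iff mem_Times_iff fst_conv snd_conv insert_iff empty_iff
    cartan_type.case List.member_iff list.set prod.inject by argo

lemma energy_exec: "energy T x y = energy_exec T x y"
  by (cases T) (simp_all add: energy_exec_def zero_D43_iff zero_G21_iff two_D43_iff two_G21_iff List.member_iff)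

text \<open>The shift is the one that the energy equation forces for these classes; the bound -3
  keeps it in the range where \<open>gained\<close> lists all blocks.\<close>

definition check_contain :: "cartan_type \<Rightarrow> bool" where
  "check_contain T \<longleftrightarrow> list_all (\<lambda>x. list_all (\<lambda>y.
     energy_exec T x y + zero_diff T x y \<ge> -3 \<and>
     gained T y x (- (energy_exec T x y + zero_diff T x y)) = []) (class_list T)) (class_list T)"

lemma check_contain: "check_contain T"
proof (cases T)
  case D43
  show ?thesis unfolding D43 by code_simp
next
  case G21
  show ?thesis unfolding G21 by code_simp
qed

text \<open>The recursion of an energy function: a 0-arrow on the right factor raises
  \<open>H\<close> by 1, on the left factor it lowers \<open>H\<close> by 1, and other arrows keep
  it. The two premises are the cases of the tensor product rule.\<close>

definition check_energy :: "cartan_type \<Rightarrow> bool" where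
  "check_energy T \<longleftrightarrow> list_all (\<lambda>i. list_all (\<lambda>y.
     (case up T i y of None \<Rightarrow> True | Some (y', e) \<Rightarrow> list_all (\<lambda>x.
       (if snd (sign_of T i x) \<le> fst (sign_of T i y)
        then energy_exec T x y' = energy_exec T x y + (if i = I0 then 1 else 0) else True) \<and>
       (if fst (sign_of T i x) < snd (sign_of T i y)
        then energy_exec T y' x = energy_exec T y x - (if i = I0 then 1 else 0) else True))
     (class_list T))) (class_list T)) [I0, I1, I2]"

lemma check_energy: "check_energy T"
proof (cases T)
  case D43
  show ?thesis unfolding D43 by code_simp
next
  case G21
  show ?thesis unfolding G21 by code_simp
qed

fun level_sum :: "cartan_type \<Rightarrow> index \<Rightarrow> int" where
  "level_sum D43 I1 = -2"
| "level_sum G21 I1 = -1"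
| "level_sum _ _ = 1"

text \<open>The number of plus signs minus the number of minus signs of a column is, up to a constant,
  the pairing of its weight with the coroot \<open>h\<^sub>i\<close>; the constant is \<open>level_sum T i\<close>, and the null
  root, the weight of a whole period, pairs to 0.\<close>

definition check_net :: "cartan_type \<Rightarrow> bool" where
  "check_net T \<longleftrightarrow> list_all (\<lambda>i.
     cartan T i I0 * period T I0 + cartan T i I1 * period T I1 + cartan T i I2 * period T I2 = 0 \<and>
     list_all (\<lambda>c. int (snd (sign_of T i c)) - int (fst (sign_of T i c)) +
       (cartan T i I0 * top_count T c I0 + cartan T i I1 * top_count T c I1 + cartan T i I2 * top_count T c I2)
       = level_sum T i) (class_list T)) [I0, I1, I2]"

lemma check_net: "check_net T"
proof (cases T)
  case D43
  show ?thesis unfolding D43 by code_simp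
next
  case G21
  show ?thesis unfolding G21 by code_simp
qed

lemma index_list: "set [I0, I1, I2] = UNIV"
  using index.exhaust by auto

lemma sum_index: "(\<Sum>j\<in>UNIV. f j) = f I0 + f I1 + f I2"
  by (subst index_list[symmetric]) (simp add: add.assoc)

section \<open>From classes to columns\<close>

lemma youngE:
  assumes "y \<in> young_columns T"
  obtains c n where "c \<in> classes T" "y = column_of T c n"
  using assms by (auto simp: young_columns_def)

lemma column_young: "c \<in> classes T \<Longrightarrow> column_of T c n \<in> young_columns T"
  by (auto simp: young_columns_def)

lemma zero_diff_bound: "-2 \<le> zero_diff T c c' \<and> zero_diff T c c' \<le> 2"
proof -
  have "0 \<le> top_count T c I0 \<and> top_count T c I0 \<le> 2" for c
    unfolding top_count_def by (induction T c rule: top_list.induct) simp_all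
  from this[of c] this[of c'] show ?thesis by (simp add: zero_diff_def)
qed

lemma counts_match_height:
  assumes "\<And>j. height T j c' n' = height T j c n + (if i = Some j then 1 else 0)"
  shows "n' - n = zero_diff T c c' + (if i = Some I0 then 1 else 0)" "counts_match T c c' (n' - n) i"
proof -
  have "period T I0 = 1" by (cases T) auto
  then show "n' - n = zero_diff T c c' + (if i = Some I0 then 1 else 0)"
    using assms[of I0] by (simp add: height_def zero_diff_def)
  show "counts_match T c c' (n' - n) i"
    using assms[of I1] assms[of I2] by (simp add: counts_match_def height_def algebra_simps)
qed

text \<open>Equal columns have equal heights in every colour; colour 0 fixes the relative index, and
  \<open>check_inj\<close> excludes distinct classes at that index. This makes the descriptions in
  \<open>class_of\<close> and \<open>shift_of\<close> definite.\<close>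

lemma column_of_inject:
  assumes "c \<in> classes T" "c' \<in> classes T" "column_of T c n = column_of T c' n'"
  shows "c = c' \<and> n = n'"
proof -
  have "height T j c' n' = height T j c n" for j
    using column_diff(2)[OF assms(1,2), of n n' j] assms(3) by simp
  then have e: "n' - n = zero_diff T c c'" "counts_match T c c' (n' - n) None"
    using counts_match_height[of T c' n' c n None] by auto
  then have "n' - n \<le> 3" using zero_diff_bound[of T c c'] by simp
  then have "gained T c c' (n' - n) = []"
    using column_gain[OF assms(1,2), of n' n] assms(3) by simp
  then have "c = c' \<and> zero_diff T c c' = 0"
    using bspec[OF bspec[OF check_inj[of T, unfolded check_inj_def list_all_iff set_class_list Let_def]
          assms(1)] assms(2)] e(2) unfolding e(1) by (auto split: if_splits)
  then show ?thesis using e(1) by auto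
qed

lemma class_of_column [simp]:
  assumes "c \<in> classes T"
  shows "class_of T (column_of T c n) = c"
  unfolding class_of_def using assms column_of_inject by (intro the_equality) blast+

definition shift_of :: "cartan_type \<Rightarrow> block set \<Rightarrow> int" where
  "shift_of T y = (THE n. y = column_of T (class_of T y) n)"

lemma shift_of_column [simp]:
  assumes "c \<in> classes T"
  shows "shift_of T (column_of T c n) = n"
  unfolding shift_of_def class_of_column[OF assms] using assms column_of_inject
  by (intro the_equality) blast+

definition col_height :: "cartan_type \<Rightarrow> index \<Rightarrow> block set \<Rightarrow> int" where
  "col_height T j y = height T j (class_of T y) (shift_of T y)"

lemma col_height_column [simp]:
  "c \<in> classes T \<Longrightarrow> col_height T j (column_of T c n) = height T j c n"
  by (simp add: col_height_def)

lemma class_in: "y \<in> young_columns T \<Longrightarrow> class_of T y \<in> classes T"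
  by (auto elim!: youngE)

lemma card_young_diff:
  fixes j :: index
  assumes "y \<in> young_columns T" "y' \<in> young_columns T" "y \<subseteq> y'"
  shows "finite {b \<in> y' - y. block_colour b = j}"
    "int (card {b \<in> y' - y. block_colour b = j}) = col_height T j y' - col_height T j y"
proof -
  obtain c n where c: "c \<in> classes T" "y = column_of T c n" using assms(1) by (rule youngE)
  obtain c' n' where c': "c' \<in> classes T" "y' = column_of T c' n'" using assms(2) by (rule youngE)
  show "finite {b \<in> y' - y. block_colour b = j}"
    "int (card {b \<in> y' - y. block_colour b = j}) = col_height T j y' - col_height T j y"
    using column_diff[OF c(1) c'(1)] assms(3) c c' by auto
qed

definition col_sign :: "cartan_type \<Rightarrow> index \<Rightarrow> block set \<Rightarrow> nat \<times> nat" where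
  "col_sign T i y = sign_of T i (class_of T y)"

lemma check_sign_at:
  assumes "c \<in> classes T"
  shows "case up T i c of
      None \<Rightarrow> snd (sign_of T i c) = 0
    | Some (c', e) \<Rightarrow> List.member (class_list T) c' \<and> (e = 0 \<or> e = 1) \<and>
        gained T c' c (- e) = [] \<and> map block_colour (gained T c c' e) = [i] \<and>
        \<not> K7_step T i c c' \<and> 0 < snd (sign_of T i c) \<and>
        sign_of T i c' = (Suc (fst (sign_of T i c)), snd (sign_of T i c) - 1)"
    "length (filter (\<lambda>b. map_option fst (up T i b) = Some c) (class_list T)) =
       (if fst (sign_of T i c) = 0 then 0 else 1)"
    "fst (sign_of T i c) + snd (sign_of T i c) \<le> 3"
  using bspec[OF bspec[OF check_sign[of T, unfolded check_sign_def list_all_iff set_class_list index_list]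
        assms] UNIV_I[of i]] by blast+

lemma up_props:
  assumes "c \<in> classes T" "up T i c = Some (c', e)"
  shows "c' \<in> classes T" "e = 0 \<or> e = 1" "gained T c' c (- e) = []"
    "map block_colour (gained T c c' e) = [i]" "\<not> K7_step T i c c'" "0 < snd (sign_of T i c)"
    "sign_of T i c' = (Suc (fst (sign_of T i c)), snd (sign_of T i c) - 1)"
  using check_sign_at(1)[OF assms(1), of i] unfolding assms(2)
  by (simp_all add: List.member_iff set_class_list)

lemma adds_block_height:
  fixes j :: index
  assumes "adds_block T i y y'"
  shows "col_height T j y' = col_height T j y + (if i = j then 1 else 0)"
proof -
  obtain b where b: "b \<notin> y" "block_colour b = i" "y' = insert b y"
    and y: "y \<in> young_columns T" "y' \<in> young_columns T"
    using assms unfolding adds_block_def by blast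
  have "{x \<in> y' - y. block_colour x = j} = (if i = j then {b} else {})" using b by auto
  then have "int (card {x \<in> y' - y. block_colour x = j}) = (if i = j then 1 else 0)"
    by (simp only:) simp
  then show ?thesis
    using card_young_diff(2)[OF y, of j] b(3) by (simp only: subset_insertI)
qed

text \<open>Adding a block raises the height of one colour by 1, which leaves one possible index for
  each pair of classes; \<open>check_up\<close> shows that the table has missed none of these, and
  \<open>check_sign\<close> that each of its entries does add a block.\<close>

lemma adds_block_iff:
  assumes "c \<in> classes T" "c' \<in> classes T"
  shows "adds_block T i (column_of T c n) (column_of T c' n') \<longleftrightarrow> up T i c = Some (c', n' - n)"
proof
  assume a: "adds_block T i (column_of T c n) (column_of T c' n')"
  have "height T j c' n' = height T j c n + (if Some i = Some j then 1 else 0)" for j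
    using adds_block_height[OF a, of j] assms by simp
  then have e: "n' - n = zero_diff T c c' + (if i = I0 then 1 else 0)" "counts_match T c c' (n' - n) (Some i)"
    using counts_match_height[of T c' n' c n "Some i"] by auto
  have "n - n' \<le> 3" using zero_diff_bound[of T c c'] e(1) by (cases "i = I0") auto
  moreover have "column_of T c n - column_of T c' n' = {}"
    using a unfolding adds_block_def by blast
  ultimately have "gained T c' c (n - n') = []"
    using column_gain[OF assms(2,1), of n n'] by simp
  then have g: "gained T c' c (- (n' - n)) = []" by simp
  have "\<not> K7_step T i c c'"
    using a assms by (simp add: adds_block_def K7_step_def)
  define d where "d = zero_diff T c c' + (if i = I0 then 1 else 0)"
  have "if counts_match T c c' d (Some i) then
        if gained T c' c (- d) = [] then if K7_step T i c c' then True else up T i c = Some (c', d) else True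
      else True"
    using bspec[OF bspec[OF bspec[OF check_up[of T, unfolded check_up_def list_all_iff set_class_list
            index_list Let_def] assms(1)] assms(2)] UNIV_I[of i]] unfolding d_def .
  moreover have "n' - n = d" using e(1) by (simp only: d_def)
  ultimately show "up T i c = Some (c', n' - n)"
    using e(2) g by (simp only: \<open>\<not> K7_step T i c c'\<close> if_True if_False simp_thms)
next
  assume u: "up T i c = Some (c', n' - n)"
  note p = up_props[OF assms(1) u]
  have le: "n' - n \<le> 3" "n - n' \<le> 3" using p(2) by auto
  obtain l d where g: "gained T c c' (n' - n) = [(l, d)]" "block_colour (l, d) = i"
    using p(4) by (cases "gained T c c' (n' - n)") auto
  have "column_of T c' n' - column_of T c n = {(l, n + d)}" "column_of T c n - column_of T c' n' = {}"
    using column_gain[OF assms(1,2) le(1)] column_gain[OF assms(2,1) le(2)] g(1) p(3) by auto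
  then have "(l, n + d) \<notin> column_of T c n" "column_of T c' n' = insert (l, n + d) (column_of T c n)"
    by blast+
  moreover have "block_colour (l, n + d) = i" using g(2) by simp
  ultimately have "\<exists>b. b \<notin> column_of T c n \<and> block_colour b = i \<and> column_of T c' n' = insert b (column_of T c n)"
    by blast
  then show "adds_block T i (column_of T c n) (column_of T c' n')"
    using assms column_young p(5) unfolding adds_block_def K7_step_def by (simp del: column_of.simps)
qed

lemma adds_blockE:
  assumes "adds_block T i y y'"
  obtains c n c' n' where "c \<in> classes T" "c' \<in> classes T" "y = column_of T c n" "y' = column_of T c' n'"
    "up T i c = Some (c', n' - n)"
proof -
  have "y \<in> young_columns T" "y' \<in> young_columns T" using assms by (auto simp: adds_block_def)
  then obtain c n c' n' where c: "c \<in> classes T" "c' \<in> classes T" "y = column_of T c n" "y' = column_of T c' n'"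
    by (auto elim!: youngE)
  then show ?thesis using that[OF c] adds_block_iff[of c T c' i n n'] assms by simp
qed

lemma adds_block_sign:
  assumes "adds_block T i y y'"
  shows "0 < snd (col_sign T i y)"
    "col_sign T i y' = (Suc (fst (col_sign T i y)), snd (col_sign T i y) - 1)"
  using assms by (auto elim!: adds_blockE simp: col_sign_def up_props)

lemma adds_block_ex1:
  assumes "y \<in> young_columns T" "0 < snd (col_sign T i y)"
  shows "\<exists>!y'. adds_block T i y y'"
proof -
  obtain c n where c: "c \<in> classes T" "y = column_of T c n" using assms(1) by (rule youngE)
  have "up T i c \<noteq> None"
  proof
    assume "up T i c = None"
    then have "snd (sign_of T i c) = 0" using check_sign_at(1)[OF c(1), of i] by simp
    then show False using c assms(2) by (simp add: col_sign_def)
  qed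
  then obtain c' e where u: "up T i c = Some (c', e)" by auto
  note c' = up_props(1)[OF c(1) u]
  show ?thesis
  proof (rule ex1I)
    show "adds_block T i y (column_of T c' (n + e))"
      using u c c' by (simp add: adds_block_iff)
    fix y' assume a: "adds_block T i y y'"
    then have "y' \<in> young_columns T" by (simp add: adds_block_def)
    then obtain d m where d: "d \<in> classes T" "y' = column_of T d m" by (rule youngE)
    then have "up T i c = Some (d, m - n)" using a c(2) adds_block_iff[OF c(1) d(1)] by simp
    then have "d = c'" "m = n + e" using u by simp_all
    then show "y' = column_of T c' (n + e)" using d(2) by simp
  qed
qed

lemma removes_block_ex1:
  assumes "y' \<in> young_columns T" "0 < fst (col_sign T i y')"
  shows "\<exists>!y. adds_block T i y y'"
proof -
  obtain c' n' where c': "c' \<in> classes T" "y' = column_of T c' n'" using assms(1) by (rule youngE)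
  let ?l = "filter (\<lambda>b. map_option fst (up T i b) = Some c') (class_list T)"
  have "length ?l = 1"
    using check_sign_at(2)[OF c'(1), of i] c' assms(2) by (simp add: col_sign_def)
  then obtain c where "?l = [c]" by (cases ?l) auto
  then have "set ?l = {c}" by simp
  then have l: "{b \<in> classes T. map_option fst (up T i b) = Some c'} = {c}"
    by (simp add: set_class_list)
  then have "c \<in> {b \<in> classes T. map_option fst (up T i b) = Some c'}" by simp
  then obtain e where c: "c \<in> classes T" "up T i c = Some (c', e)" by auto
  show ?thesis
  proof (rule ex1I)
    show "adds_block T i (column_of T c (n' - e)) y'"
      using c c' by (simp add: adds_block_iff)
    fix y assume a: "adds_block T i y y'"
    then have "y \<in> young_columns T" by (simp add: adds_block_def)
    then obtain d m where d: "d \<in> classes T" "y = column_of T d m" by (rule youngE)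
    then have u: "up T i d = Some (c', n' - m)" using a c' by (simp add: adds_block_iff)
    then have "d \<in> {b \<in> classes T. map_option fst (up T i b) = Some c'}" using d(1) by simp
    then have "d = c" unfolding l by simp
    then have "m = n' - e" using u c(2) by simp
    then show "y = column_of T c (n' - e)" using \<open>d = c\<close> d(2) by simp
  qed
qed

lemma add_block_eq:
  assumes "adds_block T i y y'"
  shows "add_block T i y = y'"
proof -
  have "y \<in> young_columns T" using assms by (simp add: adds_block_def)
  from adds_block_ex1[OF this adds_block_sign(1)[OF assms]] assms show ?thesis
    unfolding add_block_def by (rule the1_equality)
qed

lemma remove_block_eq:
  assumes "adds_block T i y y'"
  shows "remove_block T i y' = y"
proof -
  have "y' \<in> young_columns T" "0 < fst (col_sign T i y')"
    using assms adds_block_sign(2)[OF assms] by (simp_all add: adds_block_def)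
  from removes_block_ex1[OF this] assms show ?thesis
    unfolding remove_block_def by (rule the1_equality)
qed

text \<open>A shift adds a multiple of the null root, which pairs to 0 with every coroot, so only
  the class matters.\<close>

lemma col_sign_net:
  assumes "y \<in> young_columns T"
  shows "int (snd (col_sign T i y)) - int (fst (col_sign T i y)) + (\<Sum>j\<in>UNIV. cartan T i j * col_height T j y) = level_sum T i"
proof -
  obtain c n where c: "c \<in> classes T" "y = column_of T c n" using assms by (rule youngE)
  have n: "cartan T i I0 * period T I0 + cartan T i I1 * period T I1 + cartan T i I2 * period T I2 = 0"
    "int (snd (sign_of T i c)) - int (fst (sign_of T i c)) +
       (cartan T i I0 * top_count T c I0 + cartan T i I1 * top_count T c I1 + cartan T i I2 * top_count T c I2)
       = level_sum T i"
    using bspec[OF check_net[of T, unfolded check_net_def list_all_iff set_class_list index_list] UNIV_I[of i]]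
      c(1) by blast+
  have "(\<Sum>j\<in>UNIV. cartan T i j * col_height T j y) =
      (cartan T i I0 * top_count T c I0 + cartan T i I1 * top_count T c I1 + cartan T i I2 * top_count T c I2)
      + n * (cartan T i I0 * period T I0 + cartan T i I1 * period T I1 + cartan T i I2 * period T I2)"
    using c by (simp add: sum_index height_def algebra_simps)
  then show ?thesis using n c by (simp add: col_sign_def)
qed

lemma col_sign_short:
  "y \<in> young_columns T \<Longrightarrow> fst (col_sign T i y) + snd (col_sign T i y) \<le> 3"
  unfolding col_sign_def by (rule check_sign_at(3)[OF class_in])

section \<open>Adjacent columns\<close>

text \<open>The energy equation with heights in place of \<open>zero_count\<close>. Both differ by
  the constant of the ground-state column if that column is contained; heights make sense before the
  inclusion is known.\<close>

definition tight :: "cartan_type \<Rightarrow> block set \<Rightarrow> block set \<Rightarrow> bool" where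
  "tight T x y \<longleftrightarrow> energy T (class_of T x) (class_of T y) + col_height T I0 x - col_height T I0 y = 0"

lemma tight_subset:
  assumes "x \<in> young_columns T" "y \<in> young_columns T" "tight T x y"
  shows "x \<subseteq> y"
proof -
  obtain c n where c: "c \<in> classes T" "x = column_of T c n" using assms(1) by (rule youngE)
  obtain c' n' where c': "c' \<in> classes T" "y = column_of T c' n'" using assms(2) by (rule youngE)
  have "period T I0 = 1" by (cases T) auto
  then have e: "n - n' = - (energy_exec T c c' + zero_diff T c c')"
    using assms(3) c c' by (simp add: tight_def height_def zero_diff_def energy_exec)
  have "energy_exec T c c' + zero_diff T c c' \<ge> -3 \<and> gained T c' c (n - n') = []"
    using check_contain[of T] c c' unfolding e check_contain_def list_all_iff set_class_list by blast
  then have "n - n' \<le> 3" "gained T c' c (n - n') = []" using e by auto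
  then have "column_of T c n - column_of T c' n' = {}"
    using column_gain[OF c'(1) c(1), of n n'] by simp
  then show ?thesis using c c' by simp
qed

lemma energy_step:
  assumes "c \<in> classes T" "up T i c = Some (c', e)" "x \<in> classes T"
  shows "snd (sign_of T i x) \<le> fst (sign_of T i c) \<Longrightarrow>
      energy T x c' = energy T x c + (if i = I0 then 1 else 0)"
    "fst (sign_of T i x) < snd (sign_of T i c) \<Longrightarrow>
      energy T c' x = energy T c x - (if i = I0 then 1 else 0)"
proof -
  have "case up T i c of None \<Rightarrow> True | Some (y', e) \<Rightarrow> \<forall>x\<in>classes T.
       (if snd (sign_of T i x) \<le> fst (sign_of T i c)
        then energy_exec T x y' = energy_exec T x c + (if i = I0 then 1 else 0) else True) \<and>
       (if fst (sign_of T i x) < snd (sign_of T i c)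
        then energy_exec T y' x = energy_exec T c x - (if i = I0 then 1 else 0) else True)"
    using bspec[OF bspec[OF check_energy[of T, unfolded check_energy_def list_all_iff set_class_list
          index_list] UNIV_I[of i]] assms(1)] .
  then show "snd (sign_of T i x) \<le> fst (sign_of T i c) \<Longrightarrow>
      energy T x c' = energy T x c + (if i = I0 then 1 else 0)"
    "fst (sign_of T i x) < snd (sign_of T i c) \<Longrightarrow>
      energy T c' x = energy T c x - (if i = I0 then 1 else 0)"
    unfolding assms(2) energy_exec using assms(3) by auto
qed

text \<open>A 0-block added to the right column raises energy and subtracted height alike; added to
  the left column, it lowers the energy and raises the added height. In both cases the sum is
  unchanged.\<close>

lemma tight_add_right:
  assumes "x \<in> young_columns T" "adds_block T i y y'" "snd (col_sign T i x) \<le> fst (col_sign T i y)"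
  shows "tight T x y' \<longleftrightarrow> tight T x y"
  using adds_block_height[OF assms(2), of I0] assms(2,3) class_in[OF assms(1)]
  by (auto elim!: adds_blockE simp: tight_def col_sign_def energy_step(1))

lemma tight_add_left:
  assumes "x \<in> young_columns T" "adds_block T i y y'" "fst (col_sign T i x) < snd (col_sign T i y)"
  shows "tight T y' x \<longleftrightarrow> tight T y x"
  using adds_block_height[OF assms(2), of I0] assms(2,3) class_in[OF assms(1)]
  by (auto elim!: adds_blockE simp: tight_def col_sign_def energy_step(2))


section \<open>Reduced Young walls\<close>

definition crystal_weight :: "cartan_type \<Rightarrow> weight \<Rightarrow> bool" where
  "crystal_weight T \<Lambda> \<longleftrightarrow> T = D43 \<and> \<Lambda> = fund_weight I0 \<or>
     T = G21 \<and> \<Lambda> \<in> {fund_weight I0, fund_weight I2}"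

lemma fund_weight_neq: "fund_weight I2 \<noteq> fund_weight I0"
  by (simp add: fund_weight_def axis_eq_axis)

lemma ground_column_of:
  assumes "crystal_weight T \<Lambda>"
  obtains c n where "c \<in> classes T" "ground_column T \<Lambda> = column_of T c n"
    "\<And>i. fst (sign_of T i c) = snd (sign_of T i c)"
    "\<And>i. int (snd (sign_of T i c)) = coroot_pairing i \<Lambda>"
proof -
  have p: "coroot_pairing i (fund_weight j) = (if i = j then 1 else 0)" for i j
    by (auto simp: coroot_pairing_def fund_weight_def axis_def)
  consider "T = D43" "\<Lambda> = fund_weight I0" | "T = G21" "\<Lambda> = fund_weight I0" | "T = G21" "\<Lambda> = fund_weight I2"
    using assms by (auto simp: crystal_weight_def)
  then show ?thesis
  proof cases
    case 1
    have "fst (sign_of T i Kphi) = snd (sign_of T i Kphi) \<and> int (snd (sign_of T i Kphi)) = coroot_pairing i \<Lambda>" for i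
      using 1 p by (cases i) simp_all
    then show ?thesis using 1 by (intro that[of Kphi 0]) simp_all
  next
    case 2
    have "fst (sign_of T i K0) = snd (sign_of T i K0) \<and> int (snd (sign_of T i K0)) = coroot_pairing i \<Lambda>" for i
      using 2 p by (cases i) simp_all
    then show ?thesis using 2 by (intro that[of K0 0]) simp_all
  next
    case 3
    have "fst (sign_of T i Kb7) = snd (sign_of T i Kb7) \<and> int (snd (sign_of T i Kb7)) = coroot_pairing i \<Lambda>" for i
      using 3 p by (cases i) simp_all
    then show ?thesis using 3 fund_weight_neq by (intro that[of Kb7 1]) simp_all
  qed
qed

lemma ground_young: "crystal_weight T \<Lambda> \<Longrightarrow> ground_column T \<Lambda> \<in> young_columns T"
  by (erule ground_column_of) (simp add: column_young)

lemma ground_sign: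
  assumes "crystal_weight T \<Lambda>"
  shows "fst (col_sign T i (ground_column T \<Lambda>)) = snd (col_sign T i (ground_column T \<Lambda>))"
    "int (snd (col_sign T i (ground_column T \<Lambda>))) = coroot_pairing i \<Lambda>"
proof -
  obtain c n where "c \<in> classes T" "ground_column T \<Lambda> = column_of T c n"
    "fst (sign_of T i c) = snd (sign_of T i c)" "int (snd (sign_of T i c)) = coroot_pairing i \<Lambda>"
    using ground_column_of[OF assms] by metis
  then show "fst (col_sign T i (ground_column T \<Lambda>)) = snd (col_sign T i (ground_column T \<Lambda>))"
    "int (snd (col_sign T i (ground_column T \<Lambda>))) = coroot_pairing i \<Lambda>"
    by (simp_all add: col_sign_def)
qed

lemma zero_count_eq:
  assumes "crystal_weight T \<Lambda>" "y \<in> young_columns T" "ground_column T \<Lambda> \<subseteq> y"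
  shows "int (zero_count T \<Lambda> y) = col_height T I0 y - col_height T I0 (ground_column T \<Lambda>)"
  unfolding zero_count_def using card_young_diff(2)[OF ground_young[OF assms(1)] assms(2,3)] .

text \<open>Both inclusions in the definition of a Young wall follow from tightness, so reducedness
  becomes a condition on neighbours and on the far columns.\<close>

lemma reduced_walls_iff:
  assumes "crystal_weight T \<Lambda>"
  shows "Y \<in> reduced_walls T \<Lambda> \<longleftrightarrow> (\<forall>k. Y k \<in> young_columns T) \<and>
    (\<exists>N. \<forall>k\<ge>N. Y k = ground_column T \<Lambda>) \<and> (\<forall>k. tight T (Y (Suc k)) (Y k))"
proof -
  have tight: "tight T (Y (Suc k)) (Y k) \<longleftrightarrow> energy T (class_of T (Y (Suc k))) (class_of T (Y k))
      + int (zero_count T \<Lambda> (Y (Suc k))) - int (zero_count T \<Lambda> (Y k)) = 0"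
    if "\<forall>k. Y k \<in> young_columns T" "\<forall>k. ground_column T \<Lambda> \<subseteq> Y k" for k
    using that zero_count_eq[OF assms, of "Y k"] zero_count_eq[OF assms, of "Y (Suc k)"]
    by (auto simp: tight_def)
  show ?thesis
  proof
    assume "Y \<in> reduced_walls T \<Lambda>"
    then show "(\<forall>k. Y k \<in> young_columns T) \<and> (\<exists>N. \<forall>k\<ge>N. Y k = ground_column T \<Lambda>) \<and>
        (\<forall>k. tight T (Y (Suc k)) (Y k))"
      using tight unfolding reduced_walls_def young_walls_def by blast
  next
    assume h: "(\<forall>k. Y k \<in> young_columns T) \<and> (\<exists>N. \<forall>k\<ge>N. Y k = ground_column T \<Lambda>) \<and>
        (\<forall>k. tight T (Y (Suc k)) (Y k))"
    then obtain N where N: "\<And>k. N \<le> k \<Longrightarrow> Y k = ground_column T \<Lambda>" by blast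
    have s: "Y (Suc k) \<subseteq> Y k" for k using h tight_subset by blast
    \<comment> \<open>Far to the left stands the ground-state column, and columns only grow to the
      right.\<close>
    have "Y (max k N) \<subseteq> Y k" for k
      by (rule lift_Suc_antimono_le[of Y]) (use s in auto)
    then have "ground_column T \<Lambda> \<subseteq> Y k" for k using N[of "max k N"] by (metis max.cobounded2)
    then show "Y \<in> reduced_walls T \<Lambda>"
      using h s tight unfolding reduced_walls_def young_walls_def by blast
  qed
qed

lemma reduced_ground_subset:
  "Y \<in> reduced_walls T \<Lambda> \<Longrightarrow> ground_column T \<Lambda> \<subseteq> Y k"
  by (simp add: reduced_walls_def young_walls_def)

lemma wall_signs_eq: "wall_signs T i Y = (\<lambda>k. col_sign T i (Y k))"
  by (simp add: wall_signs_def col_sign_def)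

lemma short_wall_signs: "(\<And>k. Y k \<in> young_columns T) \<Longrightarrow> short (wall_signs T i Y)"
  by (simp add: short_def wall_signs_eq col_sign_short)

lemma simple_root_component: "simple_root T j $ Lam i = cartan T i j"
  unfolding simple_root_def by (cases i) (simp_all add: sum_index fund_weight_def null_root_def axis_def)

lemma coroot_wall_wt:
  "coroot_pairing i (wall_wt T \<Lambda> Y) =
     coroot_pairing i \<Lambda> - (\<Sum>j\<in>UNIV. cartan T i j * int (added_blocks T \<Lambda> j Y))"
  by (simp add: coroot_pairing_def wall_wt_def sum_index simple_root_component mult.commute)

lemma added_blocks_eq:
  fixes j :: index
  assumes "crystal_weight T \<Lambda>" "Y \<in> reduced_walls T \<Lambda>" "\<And>k. N \<le> k \<Longrightarrow> Y k = ground_column T \<Lambda>"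
  shows "finite {(k, b). b \<in> Y k - ground_column T \<Lambda> \<and> block_colour b = j}"
    "int (added_blocks T \<Lambda> j Y) = (\<Sum>k<N. col_height T j (Y k) - col_height T j (ground_column T \<Lambda>))"
proof -
  let ?g = "ground_column T \<Lambda>"
  let ?D = "\<lambda>k. {b \<in> Y k - ?g. block_colour b = j}"
  have "\<And>k. Y k \<in> young_columns T" using assms reduced_walls_iff by blast
  then have D: "finite (?D k)" "int (card (?D k)) = col_height T j (Y k) - col_height T j ?g" for k
    using card_young_diff[OF ground_young[OF assms(1)] _ reduced_ground_subset[OF assms(2)]] by blast+
  have "k < N" if "b \<in> Y k" "b \<notin> ?g" for k b
    using that assms(3)[of k] by (metis not_le)
  then have e: "{(k, b). b \<in> Y k - ?g \<and> block_colour b = j} = Sigma {..<N} ?D"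
    by auto
  show "finite {(k, b). b \<in> Y k - ?g \<and> block_colour b = j}"
    unfolding e using D by (intro finite_SigmaI) auto
  have "card (Sigma {..<N} ?D) = (\<Sum>k<N. card (?D k))"
    using D(1) by (intro card_SigmaI) blast+
  then show "int (added_blocks T \<Lambda> j Y) = (\<Sum>k<N. col_height T j (Y k) - col_height T j ?g)"
    unfolding added_blocks_def e by (simp only: of_nat_sum D(2))
qed

text \<open>Far columns have signature \<open>(t, t)\<close>, so the walk enters each of them at the
  same height \<open>A\<close> and peaks there at \<open>A + t\<close>. This is the recurring level
  that \<open>card_free\<close> asks for.\<close>

lemma wall_free_signs:
  fixes i :: index
  assumes "crystal_weight T \<Lambda>" "Y \<in> reduced_walls T \<Lambda>"
  defines "w \<equiv> word (wall_signs T i Y)"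
  shows "finite (free_plus w)" "finite (free_minus w)"
    "int (card (free_plus w)) = int (card (free_minus w)) + coroot_pairing i (wall_wt T \<Lambda> Y)"
proof -
  let ?g = "ground_column T \<Lambda>"
  have y: "\<And>k. Y k \<in> young_columns T" using assms reduced_walls_iff by blast
  obtain N where N: "\<And>k. N \<le> k \<Longrightarrow> Y k = ?g" using assms reduced_walls_iff by blast
  define t where "t = snd (col_sign T i ?g)"
  have t: "col_sign T i ?g = (t, t)" "int t = coroot_pairing i \<Lambda>"
    using ground_sign[OF assms(1), of i] by (auto simp: t_def prod_eq_iff)
  have s: "short (wall_signs T i Y)" using y by (rule short_wall_signs)
  have far: "wall_signs T i Y k = (t, t)" if "N \<le> k" for k
    using N[OF that] t by (simp add: wall_signs_eq)
  define A where "A = ht w (3 * N)"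
  have A: "ht w (3 * k) = A" if "N \<le> k" for k
    using that
  proof (induction k rule: dec_induct)
    case (step k)
    have "ht w (3 * Suc k) = ht w (3 * k) + (int (snd (wall_signs T i Y k)) - int (fst (wall_signs T i Y k)))"
      by (simp only: w_def ht_word[OF s] sum.lessThan_Suc)
    then show ?case using far[of k] step by simp
  qed (simp add: A_def)
  have le: "ht w n \<le> A + int t" if "3 * N \<le> n" for n
  proof -
    have "N \<le> n div 3" using that by simp
    then show ?thesis
      using ht_column_le[OF s, of n] A[of "n div 3"] far[of "n div 3"] by (simp add: w_def)
  qed
  have inf: "\<exists>m\<ge>n. ht w m = A + int t" for n
    using ht_plus_end[OF s, of t "max n N"] far[of "max n N"] A[of "max n N"]
    by (intro exI[of _ "3 * max n N + (3 - t)"]) (simp add: w_def)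
  have net: "int (snd (col_sign T i (Y k))) - int (fst (col_sign T i (Y k))) =
      - (\<Sum>j\<in>UNIV. cartan T i j * (col_height T j (Y k) - col_height T j ?g))" for k
    using col_sign_net[OF y, of i k] col_sign_net[OF ground_young[OF assms(1)], of i] t(1)
    by (simp add: sum_index algebra_simps)
  have added: "int (added_blocks T \<Lambda> j Y) = (\<Sum>k<N. col_height T j (Y k) - col_height T j ?g)" for j
    by (rule added_blocks_eq(2)[OF assms(1,2)]) (rule N)
  have "A = (\<Sum>k<N. - (\<Sum>j\<in>UNIV. cartan T i j * (col_height T j (Y k) - col_height T j ?g)))"
    unfolding A_def w_def ht_word[OF s] unfolding wall_signs_eq net ..
  also have "\<dots> = - (\<Sum>j\<in>UNIV. cartan T i j * int (added_blocks T \<Lambda> j Y))"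
    unfolding added
    by (simp only: sum_index sum.distrib sum_distrib_left sum_negf)
  finally have "A + int t = coroot_pairing i (wall_wt T \<Lambda> Y)"
    by (simp add: coroot_wall_wt t(2))
  then show "finite (free_plus w)" "finite (free_minus w)"
    "int (card (free_plus w)) = int (card (free_minus w)) + coroot_pairing i (wall_wt T \<Lambda> Y)"
    using card_free[of w "3 * N" "A + int t"] le inf steps_word by (auto simp: w_def)
qed

lemma wall_eps_eq:
  "(\<And>k. Y k \<in> young_columns T) \<Longrightarrow> wall_eps T i Y = int (card (free_minus (word (wall_signs T i Y))))"
  unfolding wall_eps_def
  by (simp add: remaining_minus_eq short_wall_signs card_image inj_on_subset[OF inj_position])

lemma wall_phi_eq:
  "(\<And>k. Y k \<in> young_columns T) \<Longrightarrow> wall_phi T i Y = int (card (free_plus (word (wall_signs T i Y))))"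
  unfolding wall_phi_def
  by (simp add: remaining_plus_eq short_wall_signs card_image inj_on_subset[OF inj_position])

section \<open>One step between walls\<close>

definition wall_step :: "cartan_type \<Rightarrow> index \<Rightarrow> wall \<Rightarrow> wall \<Rightarrow> bool" where
  "wall_step T i Y Y' \<longleftrightarrow> (\<exists>p y. F_pos (word (wall_signs T i Y)) p \<and>
     adds_block T i (Y (p div 3)) y \<and> Y' = Y(p div 3 := y))"

lemma wall_signs_add:
  assumes "adds_block T i (Y k) y"
  shows "wall_signs T i (Y(k := y)) = (wall_signs T i Y)
    (k := (Suc (fst (wall_signs T i Y k)), snd (wall_signs T i Y k) - 1))"
  using adds_block_sign(2)[OF assms] by (auto simp: wall_signs_eq)

lemma word_add:
  assumes "\<And>k. Y k \<in> young_columns T" "F_pos (word (wall_signs T i Y)) p"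
    "adds_block T i (Y (p div 3)) y"
  shows "word (wall_signs T i (Y(p div 3 := y))) = (word (wall_signs T i Y))(p := -1)"
proof -
  have s: "short (wall_signs T i Y)" using assms(1) by (rule short_wall_signs)
  note p = F_pos_column(1,2)[OF s assms(2) refl]
  show ?thesis
    using word_flip[OF s p(1) wall_signs_add[of T i Y "p div 3" y, OF assms(3)]] p(2) by simp
qed

lemma wall_F_iff:
  assumes "crystal_weight T \<Lambda>" "Y \<in> reduced_walls T \<Lambda>"
  shows "wall_F T i Y = Some Y' \<longleftrightarrow> wall_step T i Y Y'"
proof -
  let ?s = "wall_signs T i Y"
  have y: "\<And>k. Y k \<in> young_columns T" using assms reduced_walls_iff by blast
  have s: "short ?s" using y by (rule short_wall_signs)
  note fin = wall_free_signs(1)[OF assms, of i]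
  have F: "wall_F T i Y = Some (Y(p div 3 := y'))"
    if "F_pos (word ?s) p" "adds_block T i (Y (p div 3)) y'" for p y'
  proof -
    have "remaining_plus ?s \<noteq> {}"
      using that(1) unfolding remaining_plus_eq[OF s] F_pos_iff[OF steps_word] by blast
    then show ?thesis
      unfolding wall_F_def Let_def Max_remaining_plus[OF s fin that(1)] add_block_eq[OF that(2)] by simp
  qed
  show ?thesis
  proof
    assume a: "wall_F T i Y = Some Y'"
    then have "remaining_plus ?s \<noteq> {}" by (auto simp: wall_F_def Let_def)
    then obtain p where p: "F_pos (word ?s) p"
      using F_pos_exists[OF fin] unfolding remaining_plus_eq[OF s] by blast
    have "0 < snd (col_sign T i (Y (p div 3)))"
      using F_pos_column(1)[OF s p refl] by (simp add: wall_signs_eq)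
    then obtain y' where "adds_block T i (Y (p div 3)) y'" using adds_block_ex1[OF y] by blast
    then show "wall_step T i Y Y'" using F[OF p] a p by (auto simp: wall_step_def)
  next
    assume "wall_step T i Y Y'"
    then show "wall_F T i Y = Some Y'" using F by (auto simp: wall_step_def)
  qed
qed

lemma wall_step_young:
  assumes "wall_step T i Y Y'"
  shows "(\<forall>k. Y k \<in> young_columns T) \<longleftrightarrow> (\<forall>k. Y' k \<in> young_columns T)"
proof -
  obtain p z where "adds_block T i (Y (p div 3)) z" "Y' = Y(p div 3 := z)"
    using assms by (auto simp: wall_step_def)
  moreover from this(1) have "Y (p div 3) \<in> young_columns T" "z \<in> young_columns T"
    by (simp_all add: adds_block_def)
  ultimately show ?thesis by (metis fun_upd_apply)
qed

text \<open>The maximum condition for adding a block refers to the word of \<open>Y\<close>, which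
  is known only after the removal; flipping the letter back converts \<open>E_pos\<close> for
  \<open>Y'\<close> into \<open>F_pos\<close> for \<open>Y\<close>.\<close>

lemma wall_E_iff:
  assumes "crystal_weight T \<Lambda>" "Y' \<in> reduced_walls T \<Lambda>"
  shows "wall_E T i Y' = Some Y \<longleftrightarrow> wall_step T i Y Y'"
proof -
  let ?s = "wall_signs T i Y'"
  have y: "\<And>k. Y' k \<in> young_columns T" using assms reduced_walls_iff by blast
  have s: "short ?s" using y by (rule short_wall_signs)
  note fin = wall_free_signs(2)[OF assms, of i]
  have E: "wall_E T i Y' = Some (Y'(p div 3 := z))"
    if "E_pos (word ?s) p" "adds_block T i z (Y' (p div 3))" for p z
  proof -
    have "remaining_minus ?s \<noteq> {}"
      using that(1) unfolding remaining_minus_eq[OF s] E_pos_iff[OF steps_word] by blast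
    then show ?thesis
      unfolding wall_E_def Let_def Min_remaining_minus[OF s fin that(1)] remove_block_eq[OF that(2)] by simp
  qed
  show ?thesis
  proof
    assume a: "wall_E T i Y' = Some Y"
    then have "remaining_minus ?s \<noteq> {}" by (auto simp: wall_E_def Let_def)
    then obtain p where p: "E_pos (word ?s) p"
      using E_pos_exists[OF fin] unfolding remaining_minus_eq[OF s] by blast
    define k where "k = p div 3"
    note pc = E_pos_column[OF s p k_def]
    have "0 < fst (col_sign T i (Y' k))"
      using pc(1) by (simp add: wall_signs_eq)
    then obtain z where z: "adds_block T i z (Y' k)" using removes_block_ex1[OF y] by blast
    have Y: "Y = Y'(k := z)" using E[OF p] z a by (simp add: k_def)
    then have Y': "Y' = Y(k := Y' k)" and zk: "adds_block T i (Y k) (Y' k)" using z by auto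
    let ?t = "wall_signs T i Y"
    have "\<And>k. Y k \<in> young_columns T" using y z by (auto simp: Y adds_block_def)
    then have t: "short ?t" by (rule short_wall_signs)
    have a0: "0 < snd (?t k)" using adds_block_sign(1)[OF zk] by (simp add: wall_signs_eq)
    have st: "?s = ?t(k := (Suc (fst (?t k)), snd (?t k) - 1))"
      using wall_signs_add[of T i Y k "Y' k"] zk Y' by simp
    \<comment> \<open>With one minus more, the right-most minus sits where the left-most plus was:
      \<open>3 - Suc r\<close> equals \<open>2 - r\<close>.\<close>
    then have pt: "p = 3 * k + (2 - fst (?t k))" using pc(2) by simp
    have "fst (?t k) + snd (?t k) \<le> 3" using t by (simp add: short_def)
    then have "plus_at ?t (position p)" using a0 position_surj[of "fst (?t k)" k] by (simp add: pt)
    then have w1: "word ?t p = 1" by (simp add: plus_at_position)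
    have "word ?s = (word ?t)(p := -1)" using word_flip[OF t a0 st] by (simp add: pt)
    then have "F_pos (word ?t) p" using p E_pos_flip[of "word ?t" p, OF w1] by simp
    then show "wall_step T i Y Y'" using zk Y' unfolding wall_step_def k_def by blast
  next
    assume st: "wall_step T i Y Y'"
    then obtain p z where p: "F_pos (word (wall_signs T i Y)) p" "adds_block T i (Y (p div 3)) z"
      "Y' = Y(p div 3 := z)" by (auto simp: wall_step_def)
    have "\<And>k. Y k \<in> young_columns T" using wall_step_young[OF st] y by blast
    then have "word ?s = (word (wall_signs T i Y))(p := -1)" using word_add p by simp
    then have "E_pos (word ?s) p"
      using p(1) E_pos_flip[of "word (wall_signs T i Y)" p] by (simp add: F_pos_def)
    then have "wall_E T i Y' = Some (Y'(p div 3 := Y (p div 3)))" using E p by simp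
    then show "wall_E T i Y' = Some Y" using p(3) by simp
  qed
qed

text \<open>Only the two pairs of neighbours that contain the changed column matter, and for them
  \<open>F_pos_column\<close> supplies the premises of the two tightness lemmas. As an equivalence
  it serves both operators.\<close>

lemma wall_step_reduced:
  assumes "crystal_weight T \<Lambda>" "wall_step T i Y Y'"
  shows "Y \<in> reduced_walls T \<Lambda> \<longleftrightarrow> Y' \<in> reduced_walls T \<Lambda>"
proof (cases "\<forall>k. Y k \<in> young_columns T")
  case False
  then show ?thesis using wall_step_young[OF assms(2)] reduced_walls_iff[OF assms(1)] by blast
next
  case True
  obtain p z where p: "F_pos (word (wall_signs T i Y)) p" "adds_block T i (Y (p div 3)) z"
    "Y' = Y(p div 3 := z)" using assms(2) by (auto simp: wall_step_def)
  define k where "k = p div 3"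
  have s: "short (wall_signs T i Y)" using True by (simp add: short_wall_signs)
  note c = F_pos_column(3,4)[OF s p(1) k_def]
  have a: "adds_block T i (Y k) z" "Y' = Y(k := z)" using p by (auto simp: k_def)
  have "tight T (Y' (Suc m)) (Y' m) \<longleftrightarrow> tight T (Y (Suc m)) (Y m)" for m
  proof -
    consider "m = k" | "k = Suc m" | "m \<noteq> k" "Suc m \<noteq> k" by blast
    then show ?thesis
    proof cases
      case 1
      then show ?thesis
        using tight_add_right[of "Y (Suc k)" T i "Y k" z] True a c(1) by (simp add: wall_signs_eq)
    next
      case 2
      then show ?thesis
        using tight_add_left[of "Y m" T i "Y k" z] True a c(2)[OF 2] by (simp add: wall_signs_eq)
    qed (simp add: a)
  qed
  moreover have "(\<exists>N. \<forall>l\<ge>N. Y' l = ground_column T \<Lambda>) \<longleftrightarrow> (\<exists>N. \<forall>l\<ge>N. Y l = ground_column T \<Lambda>)"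
  proof
    assume "\<exists>N. \<forall>l\<ge>N. Y' l = ground_column T \<Lambda>"
    then obtain N where "\<forall>l\<ge>N. Y' l = ground_column T \<Lambda>" by blast
    then have "\<forall>l\<ge>max N (Suc k). Y l = ground_column T \<Lambda>" unfolding a(2) by fastforce
    then show "\<exists>N. \<forall>l\<ge>N. Y l = ground_column T \<Lambda>" by blast
  next
    assume "\<exists>N. \<forall>l\<ge>N. Y l = ground_column T \<Lambda>"
    then obtain N where "\<forall>l\<ge>N. Y l = ground_column T \<Lambda>" by blast
    then have "\<forall>l\<ge>max N (Suc k). Y' l = ground_column T \<Lambda>" unfolding a(2) by fastforce
    then show "\<exists>N. \<forall>l\<ge>N. Y' l = ground_column T \<Lambda>" by blast
  qed
  ultimately show ?thesis
    using wall_step_young[OF assms(2)] unfolding reduced_walls_iff[OF assms(1)] by simp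
qed

lemma wall_step_eps_phi:
  assumes "crystal_weight T \<Lambda>" "wall_step T i Y Y'" "Y \<in> reduced_walls T \<Lambda>"
  shows "wall_eps T i Y' = wall_eps T i Y + 1" "wall_phi T i Y' = wall_phi T i Y - 1"
proof -
  have y: "\<And>k. Y k \<in> young_columns T" "\<And>k. Y' k \<in> young_columns T"
    using assms reduced_walls_iff wall_step_young[OF assms(2)] by blast+
  obtain p z where p: "F_pos (word (wall_signs T i Y)) p" "adds_block T i (Y (p div 3)) z"
    "Y' = Y(p div 3 := z)" using assms(2) by (auto simp: wall_step_def)
  let ?w = "word (wall_signs T i Y)" and ?w' = "word (wall_signs T i Y')"
  have w': "?w' = ?w(p := -1)" using word_add[OF y(1) p(1,2)] p(3) by simp
  have f: "free_plus ?w' = free_plus ?w - {p}" "free_minus ?w' = insert p (free_minus ?w)"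
    unfolding w' using free_plus_flip[OF p(1)] free_minus_flip[OF p(1)] by auto
  have "p \<in> free_plus ?w" "p \<notin> free_minus ?w"
    using p(1) by (auto simp: F_pos_def free_plus_def free_minus_def)
  moreover have "finite (free_plus ?w)" "finite (free_minus ?w)"
    using wall_free_signs(1,2)[OF assms(1,3)] by blast+
  moreover have "0 < card (free_plus ?w)" using calculation by (auto simp: card_gt_0_iff)
  ultimately show "wall_eps T i Y' = wall_eps T i Y + 1" "wall_phi T i Y' = wall_phi T i Y - 1"
    unfolding wall_eps_eq[OF y(1)] wall_eps_eq[OF y(2)] wall_phi_eq[OF y(1)] wall_phi_eq[OF y(2)] f
    by simp_all
qed

lemma wall_step_added:
  fixes j :: index
  assumes "crystal_weight T \<Lambda>" "wall_step T i Y Y'" "Y \<in> reduced_walls T \<Lambda>"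
  shows "added_blocks T \<Lambda> j Y' = added_blocks T \<Lambda> j Y + (if i = j then 1 else 0)"
proof -
  obtain p z where p: "adds_block T i (Y (p div 3)) z" "Y' = Y(p div 3 := z)"
    using assms(2) by (auto simp: wall_step_def)
  define k where "k = p div 3"
  obtain b where b: "b \<notin> Y k" "block_colour b = i" "z = insert b (Y k)"
    using p(1) unfolding adds_block_def k_def by blast
  obtain N where N: "\<And>k. N \<le> k \<Longrightarrow> Y k = ground_column T \<Lambda>"
    using assms reduced_walls_iff by blast
  have fin: "finite {(k, b). b \<in> Y k - ground_column T \<Lambda> \<and> block_colour b = j}"
    by (rule added_blocks_eq(1)[OF assms(1,3)]) (rule N)
  have "b \<notin> ground_column T \<Lambda>" using b reduced_ground_subset[OF assms(3)] by blast
  then have e: "{(l, x). x \<in> Y' l - ground_column T \<Lambda> \<and> block_colour x = j} =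
      (if i = j then insert (k, b) {(l, x). x \<in> Y l - ground_column T \<Lambda> \<and> block_colour x = j}
       else {(l, x). x \<in> Y l - ground_column T \<Lambda> \<and> block_colour x = j})"
    using b p by (auto simp: k_def split: if_splits)
  show ?thesis
    unfolding added_blocks_def e using fin b(1) by (simp del: block_colour.simps)
qed

lemma wall_step_wt:
  assumes "crystal_weight T \<Lambda>" "wall_step T i Y Y'" "Y \<in> reduced_walls T \<Lambda>"
  shows "wall_wt T \<Lambda> Y' = wall_wt T \<Lambda> Y - simple_root T i"
  unfolding wall_wt_def wall_step_added[OF assms]
  by (cases i) (simp_all add: vec_eq_iff sum_index algebra_simps)

theorem theorem4p2:
  fixes T :: cartan_type and \<Lambda> :: weight
  assumes "(T = D43 \<and> \<Lambda> = fund_weight I0) \<or>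
           (T = G21 \<and> \<Lambda> \<in> {fund_weight I0, fund_weight I2})"
  shows "affine_crystal T (reduced_walls T \<Lambda>) (wall_wt T \<Lambda>)
           (wall_E T) (wall_F T)
           (\<lambda>i Y. Zfin (wall_eps T i Y)) (\<lambda>i Y. Zfin (wall_phi T i Y))"
proof -
  have w: "crystal_weight T \<Lambda>" using assms by (simp add: crystal_weight_def)
  have y: "\<And>k. Y k \<in> young_columns T" if "Y \<in> reduced_walls T \<Lambda>" for Y
    using that reduced_walls_iff[OF w] by blast
  have "wall_phi T i Y = wall_eps T i Y + coroot_pairing i (wall_wt T \<Lambda> Y)"
    if "Y \<in> reduced_walls T \<Lambda>" for i Y
    using wall_free_signs(3)[OF w that] wall_eps_eq[OF y[OF that]] wall_phi_eq[OF y[OF that]] by simp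
  moreover note F = wall_F_iff[OF w] and E = wall_E_iff[OF w] and R = wall_step_reduced[OF w]
  ultimately show ?thesis
    unfolding affine_crystal_def
    using R by (auto simp: F E wall_step_wt[OF w] wall_step_eps_phi[OF w])
qed

end
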